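(* Let $G$ be an amenable group and let $A,B\subset G$ be subsets with $\sigma^R(A)>0$ and $\sigma^R(B)>0$. Then the set $ABB^{-1}A^{-1}$ is a neighborhood of the unit $1_G$ in the Bohr topology of $G$.
   Context: A group $G$ is amenable if it admits a left-invariant finitely additive probability measure defined on all subsets of $G$. For $A\subset G$, $\sigma^R(A)=\inf_{F}\sup_{y\in G}\frac{|F\cap Ay|}{|F|}$, where $F$ runs over all non-empty finite subsets of $G$. The Bohr topology on a group $G$ is the smallest topology on $G$ for which the canonical homomorphism $\eta:G\to bG$ is continuous, where $(bG,\eta)$ is the Bohr compactification of $G$: $bG$ is a compact Hausdorff topological group and $\eta:G\to bG$ is a homomorphism such that every homomorphism $f:G\to K$ to a compact Hausdorff topological group factors as $f=\bar f\circ\eta$ for a unique continuous homomorphism $\bar f:bG\to K$. Here $ABB^{-1}A^{-1}=\{a_1b_1b_2^{-1}a_2^{-1}:a_1,a_2\in A,\ b_1,b_2\in B\}$. *)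

theory Defs
  imports "HOL-Analysis.Analysis" "HOL-Algebra.Product_Groups"
begin

(* the closure_of of HOL-Algebra clashes with the topological closure *)
no_notation eq_closure_of ("closure'_of\<index>")

section \<open>Amenability and the density \<open>\<sigma>\<^sup>R\<close>\<close>

definition amenable_group :: "('a, 'm) monoid_scheme \<Rightarrow> bool" where
  "amenable_group G \<longleftrightarrow> group G \<and>
     (\<exists>\<mu> :: 'a set \<Rightarrow> real.
        (\<forall>A. A \<subseteq> carrier G \<longrightarrow> 0 \<le> \<mu> A) \<and>
        \<mu> (carrier G) = 1 \<and>
        additive (Pow (carrier G)) \<mu> \<and>
        (\<forall>x \<in> carrier G. \<forall>A. A \<subseteq> carrier G \<longrightarrow> \<mu> (x <#\<^bsub>G\<^esub> A) = \<mu> A))"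

text \<open>The infimum and the suprema range over nonempty sets of reals in \<open>[0, 1]\<close>, so the
  conditionally complete operators on \<^typ>\<open>real\<close> give the actual infimum and suprema.\<close>

definition sigma_R :: "('a, 'm) monoid_scheme \<Rightarrow> 'a set \<Rightarrow> real" where
  "sigma_R G A =
     (INF F \<in> {F. F \<subseteq> carrier G \<and> finite F \<and> F \<noteq> {}}.
        SUP y \<in> carrier G. real (card (F \<inter> (A #>\<^bsub>G\<^esub> y))) / real (card F))"


section \<open>Bohr compactification and Bohr topology\<close>

locale compact_hausdorff_group = group K for K (structure) +
  fixes S
  assumes topspace_eq: "topspace S = carrier K"
    and compact: "compact_space S"
    and Hausdorff: "Hausdorff_space S"
    and continuous_mult: "continuous_map (prod_topology S S) S (\<lambda>(x, y). x \<otimes> y)"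
    and continuous_inv: "continuous_map S S (\<lambda>x. inv x)"

text \<open>Uniqueness of the factorization is uniqueness as a function on \<open>carrier bG\<close>, which
  \<open>extensional\<close> turns into equality of HOL functions.\<close>

definition factors_uniquely ::
  "('a, 'm) monoid_scheme \<Rightarrow> 'b monoid \<Rightarrow> 'b topology \<Rightarrow> ('a \<Rightarrow> 'b) \<Rightarrow>
     ('k, 'l) monoid_scheme \<Rightarrow> 'k topology \<Rightarrow> bool" where
  "factors_uniquely G bG T \<eta> K S \<longleftrightarrow>
     (\<forall>f \<in> hom G K. \<exists>!g. g \<in> hom bG K \<and> g \<in> extensional (carrier bG) \<and>
        continuous_map T S g \<and> (\<forall>x \<in> carrier G. g (\<eta> x) = f x))"

text \<open>A definition cannot quantify over the type of the elements of the target group. It is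
  enough to test targets in the type \<^typ>\<open>'a set set\<close>, because a Hausdorff space with a dense
  image of \<open>G\<close> embeds into the double power set of \<open>G\<close>, and targets in the type of \<open>bG\<close>
  itself, which force \<open>\<eta>\<close> to have dense image. Theorem \<open>bohr_compactification_universal\<close> below
  derives the universal property for compact Hausdorff groups over an arbitrary type, and
  \<open>bohr_compactification_exists\<close> shows that every group has a Bohr compactification.\<close>

definition bohr_compactification ::
  "('a, 'm) monoid_scheme \<Rightarrow> 'b monoid \<Rightarrow> 'b topology \<Rightarrow> ('a \<Rightarrow> 'b) \<Rightarrow> bool" where
  "bohr_compactification G bG T \<eta> \<longleftrightarrow>
     compact_hausdorff_group bG T \<and> \<eta> \<in> hom G bG \<and>
     (\<forall>(K :: 'a set set monoid) S. compact_hausdorff_group K S \<longrightarrow> factors_uniquely G bG T \<eta> K S) \<and>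
     (\<forall>(K :: 'b monoid) S. compact_hausdorff_group K S \<longrightarrow> factors_uniquely G bG T \<eta> K S)"

definition bohr_topology ::
  "('a, 'm) monoid_scheme \<Rightarrow> 'b topology \<Rightarrow> ('a \<Rightarrow> 'b) \<Rightarrow> 'a topology" where
  "bohr_topology G T \<eta> = pullback_topology (carrier G) \<eta> T"

lemma bohr_topology_smallest:
  assumes "bohr_compactification G bG T \<eta>"
  shows "topspace (bohr_topology G T \<eta>) = carrier G"
    and "continuous_map (bohr_topology G T \<eta>) T \<eta>"
    and "\<lbrakk>topspace X = carrier G; continuous_map X T \<eta>; openin (bohr_topology G T \<eta>) U\<rbrakk> \<Longrightarrow> openin X U"
proof -
  have e: "\<eta> \<in> carrier G \<rightarrow> topspace T"
    using assms by (auto simp: bohr_compactification_def hom_def compact_hausdorff_group_def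
        compact_hausdorff_group_axioms_def)
  then show ts: "topspace (bohr_topology G T \<eta>) = carrier G"
    by (auto simp: bohr_topology_def topspace_pullback_topology)
  show "continuous_map (bohr_topology G T \<eta>) T \<eta>"
    unfolding continuous_map_def ts using e
    by (auto simp: bohr_topology_def openin_pullback_topology)
  assume X: "topspace X = carrier G" "continuous_map X T \<eta>" "openin (bohr_topology G T \<eta>) U"
  then obtain V where V: "openin T V" "U = \<eta> -` V \<inter> carrier G"
    by (auto simp: bohr_topology_def openin_pullback_topology)
  have "U = {x \<in> topspace X. \<eta> x \<in> V}" using V X by auto
  then show "openin X U" using X V openin_continuous_map_preimage by metis
qed


section \<open>The universal property for targets over arbitrary types\<close>

lemma compact_hausdorff_group_closure:
  assumes "compact_hausdorff_group K S" and H: "subgroup H K"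
  shows "subgroup (S closure_of H) K"
    and "compact_hausdorff_group (K\<lparr>carrier := S closure_of H\<rparr>) (subtopology S (S closure_of H))"
proof -
  interpret K: compact_hausdorff_group K S by fact
  let ?C = "S closure_of H"
  have sub: "?C \<subseteq> carrier K" using closure_of_subset_topspace[of S H] by (simp add: K.topspace_eq)
  have HC: "H \<subseteq> ?C" by (rule closure_of_subset) (simp add: K.topspace_eq subgroup.subset[OF H])
  have m: "x \<otimes>\<^bsub>K\<^esub> y \<in> ?C" if "x \<in> ?C" "y \<in> ?C" for x y
  proof -
    have "(\<lambda>(x, y). x \<otimes>\<^bsub>K\<^esub> y) ` (prod_topology S S closure_of (H \<times> H)) \<subseteq>
        S closure_of ((\<lambda>(x, y). x \<otimes>\<^bsub>K\<^esub> y) ` (H \<times> H))"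
      by (rule continuous_map_image_closure_subset[OF K.continuous_mult])
    also have "\<dots> \<subseteq> ?C"
      by (rule closure_of_mono) (auto intro: subgroup.m_closed[OF H])
    finally show ?thesis using that by (auto simp: closure_of_Times)
  qed
  have i: "inv\<^bsub>K\<^esub> x \<in> ?C" if "x \<in> ?C" for x
  proof -
    have "(\<lambda>x. inv\<^bsub>K\<^esub> x) ` ?C \<subseteq> S closure_of ((\<lambda>x. inv\<^bsub>K\<^esub> x) ` H)"
      by (rule continuous_map_image_closure_subset[OF K.continuous_inv])
    also have "\<dots> \<subseteq> ?C"
      by (rule closure_of_mono) (auto intro: subgroup.m_inv_closed[OF H])
    finally show ?thesis using that by auto
  qed
  show C: "subgroup ?C K"
    by (rule K.subgroupI) (use sub HC subgroup.one_closed[OF H] m i in auto)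
  interpret L: group "K\<lparr>carrier := ?C\<rparr>" by (rule K.subgroup_imp_group[OF C])
  show "compact_hausdorff_group (K\<lparr>carrier := ?C\<rparr>) (subtopology S ?C)"
  proof
    show "topspace (subtopology S ?C) = carrier (K\<lparr>carrier := ?C\<rparr>)"
      using sub K.topspace_eq by auto
    show "compact_space (subtopology S ?C)"
      by (simp add: closedin_compact_space K.compact compact_space_subtopology)
    show "Hausdorff_space (subtopology S ?C)"
      by (simp add: Hausdorff_space_subtopology K.Hausdorff)
    show "continuous_map (prod_topology (subtopology S ?C) (subtopology S ?C)) (subtopology S ?C)
        (\<lambda>(x, y). x \<otimes>\<^bsub>K\<lparr>carrier := ?C\<rparr>\<^esub> y)"
      using K.continuous_mult m
      by (auto simp: continuous_map_in_subtopology prod_topology_subtopology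
          intro: continuous_map_from_subtopology)
    have "continuous_map (subtopology S ?C) (subtopology S ?C) (\<lambda>x. inv\<^bsub>K\<^esub> x)"
      using K.continuous_inv i
      by (auto simp: continuous_map_in_subtopology intro: continuous_map_from_subtopology)
    then show "continuous_map (subtopology S ?C) (subtopology S ?C) (\<lambda>x. inv\<^bsub>K\<lparr>carrier := ?C\<rparr>\<^esub> x)"
      by (rule continuous_map_eq) (auto simp: K.m_inv_consistent[OF C])
  qed
qed

lemma compact_hausdorff_group_transport:
  assumes "compact_hausdorff_group K S" and inj: "inj_on \<phi> (carrier K)"
  defines "\<psi> \<equiv> inv_into (carrier K) \<phi>"
  defines "L \<equiv> \<lparr>carrier = \<phi> ` carrier K, monoid.mult = (\<lambda>x y. \<phi> (\<psi> x \<otimes>\<^bsub>K\<^esub> \<psi> y)), one = \<phi> \<one>\<^bsub>K\<^esub>\<rparr>"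
  defines "R \<equiv> pullback_topology (\<phi> ` carrier K) \<psi> S"
  shows "compact_hausdorff_group L R" "\<phi> \<in> hom K L" "\<psi> \<in> hom L K" "continuous_map R S \<psi>"
    "\<And>x. x \<in> carrier K \<Longrightarrow> \<psi> (\<phi> x) = x"
proof -
  interpret K: compact_hausdorff_group K S by fact
  show \<psi>\<phi>: "\<psi> (\<phi> x) = x" if "x \<in> carrier K" for x using that inj by (simp add: \<psi>_def)
  interpret L: group L
  proof (rule groupI)
    fix x assume "x \<in> carrier L"
    then obtain a where a: "a \<in> carrier K" "x = \<phi> a" by (auto simp: L_def)
    then show "\<exists>y \<in> carrier L. y \<otimes>\<^bsub>L\<^esub> x = \<one>\<^bsub>L\<^esub>"
      by (intro bexI[of _ "\<phi> (inv\<^bsub>K\<^esub> a)"]) (auto simp: L_def \<psi>\<phi>)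
  qed (auto simp: L_def \<psi>\<phi> K.m_assoc)
  show hom: "\<phi> \<in> hom K L" "\<psi> \<in> hom L K" by (auto simp: hom_def L_def \<psi>\<phi>)
  have tR: "topspace R = \<phi> ` carrier K"
    by (auto simp: R_def topspace_pullback_topology K.topspace_eq \<psi>\<phi>)
  show c\<psi>: "continuous_map R S \<psi>"
    unfolding continuous_map_def tR
    by (auto simp: K.topspace_eq \<psi>\<phi> R_def openin_pullback_topology)
  have c\<phi>: "continuous_map S R \<phi>"
    unfolding continuous_map_def tR
  proof (intro conjI allI impI)
    fix U assume "openin R U"
    then obtain V where V: "openin S V" "U = \<psi> -` V \<inter> \<phi> ` carrier K"
      by (auto simp: R_def openin_pullback_topology)
    have "V \<subseteq> carrier K" using openin_subset[OF V(1)] by (simp add: K.topspace_eq)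
    then have "{x \<in> topspace S. \<phi> x \<in> U} = V" by (auto simp: V(2) K.topspace_eq \<psi>\<phi> dest: inj_onD[OF inj])
    with V(1) show "openin S {x \<in> topspace S. \<phi> x \<in> U}" by simp
  qed (auto simp: K.topspace_eq)
  have "homeomorphic_maps R S \<psi> \<phi>"
    using c\<psi> c\<phi> by (auto simp: homeomorphic_maps_def tR K.topspace_eq \<psi>\<phi>)
  then have RS: "R homeomorphic_space S" by (auto simp: homeomorphic_space_def)
  show "compact_hausdorff_group L R"
  proof
    show "topspace R = carrier L" by (simp add: tR L_def)
    show "compact_space R" using homeomorphic_compact_space[OF RS] K.compact by simp
    show "Hausdorff_space R" using homeomorphic_Hausdorff_space[OF RS] K.Hausdorff by simp
    have "continuous_map (prod_topology R R) (prod_topology S S) (\<lambda>(x, y). (\<psi> x, \<psi> y))"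
      using c\<psi> by (simp add: continuous_map_prod_top)
    then have "continuous_map (prod_topology R R) R (\<phi> \<circ> ((\<lambda>(x, y). x \<otimes>\<^bsub>K\<^esub> y) \<circ> (\<lambda>(x, y). (\<psi> x, \<psi> y))))"
      by (rule continuous_map_compose[OF continuous_map_compose[OF _ K.continuous_mult] c\<phi>])
    then show "continuous_map (prod_topology R R) R (\<lambda>(x, y). x \<otimes>\<^bsub>L\<^esub> y)"
      by (rule continuous_map_eq) (auto simp: L_def)
    have "continuous_map R R (\<phi> \<circ> ((\<lambda>x. inv\<^bsub>K\<^esub> x) \<circ> \<psi>))"
      by (rule continuous_map_compose[OF continuous_map_compose[OF c\<psi> K.continuous_inv] c\<phi>])
    then show "continuous_map R R (\<lambda>x. inv\<^bsub>L\<^esub> x)"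
    proof (rule continuous_map_eq)
      fix x assume "x \<in> topspace R"
      then show "(\<phi> \<circ> ((\<lambda>x. inv\<^bsub>K\<^esub> x) \<circ> \<psi>)) x = inv\<^bsub>L\<^esub> x"
        by (intro L.inv_equality[symmetric]) (auto simp: tR L_def \<psi>\<phi>)
    qed
  qed
qed

lemma compact_hausdorff_group_small:
  fixes G :: "('a, 'm) monoid_scheme"
  assumes "group G" and "compact_hausdorff_group K S" and f: "f \<in> hom G K"
  obtains L :: "'a set set monoid" and R f' h
  where "compact_hausdorff_group L R" "f' \<in> hom G L" "h \<in> hom L K" "continuous_map R S h"
    "\<And>x. x \<in> carrier G \<Longrightarrow> h (f' x) = f x"
proof -
  interpret G: group G by fact
  interpret K: compact_hausdorff_group K S by fact
  interpret f: group_hom G K f by unfold_locales (fact f)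
  let ?H = "f ` carrier G"
  let ?C = "S closure_of ?H"
  let ?K = "K\<lparr>carrier := ?C\<rparr>"
  let ?S = "subtopology S ?C"
  have H: "subgroup ?H K" by (rule f.img_is_subgroup)
  have HC: "?H \<subseteq> ?C" by (rule closure_of_subset) (simp add: K.topspace_eq subgroup.subset[OF H])
  note C = compact_hausdorff_group_closure[OF assms(2) H]
  define \<phi> :: "_ \<Rightarrow> 'a set set"
    where "\<phi> x = {{g \<in> carrier G. f g \<in> U} | U. openin S U \<and> x \<in> U}" for x
  have inj: "inj_on \<phi> (carrier ?K)"
  proof (rule inj_onI, rule ccontr)
    fix x y assume xy: "x \<in> carrier ?K" "y \<in> carrier ?K" "\<phi> x = \<phi> y" "x \<noteq> y"
    then have "x \<in> topspace S" "y \<in> topspace S" by (auto simp: in_closure_of)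
    then obtain U V where UV: "openin S U" "openin S V" "x \<in> U" "y \<in> V" "disjnt U V"
      using K.Hausdorff xy(4) unfolding Hausdorff_space_def by metis
    then have "{g \<in> carrier G. f g \<in> U} \<in> \<phi> y" using xy(3) by (auto simp: \<phi>_def)
    then obtain U' where U': "openin S U'" "y \<in> U'" "{g \<in> carrier G. f g \<in> U} = {g \<in> carrier G. f g \<in> U'}"
      by (auto simp: \<phi>_def)
    have "openin S (U' \<inter> V)" "y \<in> U' \<inter> V" "y \<in> ?C" using U' UV xy by auto
    then obtain g where "g \<in> carrier G" "f g \<in> U' \<inter> V" unfolding in_closure_of by blast
    then show False using U'(3) UV(5) by (auto simp: disjnt_iff)
  qed
  note t = compact_hausdorff_group_transport[OF C(2) inj]
  let ?\<psi> = "inv_into (carrier ?K) \<phi>"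
  show thesis
  proof (rule that[OF t(1) _ _ _])
    show "\<phi> \<circ> f \<in> hom G \<lparr>carrier = \<phi> ` carrier ?K,
        monoid.mult = \<lambda>x y. \<phi> (?\<psi> x \<otimes>\<^bsub>?K\<^esub> ?\<psi> y), one = \<phi> \<one>\<^bsub>?K\<^esub>\<rparr>"
      by (rule hom_compose[OF _ t(2)]) (use f HC in \<open>auto simp: hom_def\<close>)
    show "?\<psi> \<in> hom \<lparr>carrier = \<phi> ` carrier ?K,
        monoid.mult = \<lambda>x y. \<phi> (?\<psi> x \<otimes>\<^bsub>?K\<^esub> ?\<psi> y), one = \<phi> \<one>\<^bsub>?K\<^esub>\<rparr> K"
      using t(3) closure_of_subset_topspace[of S ?H] K.topspace_eq by (auto simp: hom_def Pi_iff)
    show "continuous_map (pullback_topology (\<phi> ` carrier ?K) ?\<psi> ?S) S ?\<psi>"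
      using t(4) by (simp add: continuous_map_in_subtopology)
    show "?\<psi> ((\<phi> \<circ> f) x) = f x" if "x \<in> carrier G" for x
      using t(5)[of "f x"] that HC by auto
  qed
qed

lemma factors_uniquely_if_dense:
  fixes G :: "('a, 'm) monoid_scheme" and bG :: "'b monoid"
  assumes "group G" and bG: "compact_hausdorff_group bG T" and eta: "\<eta> \<in> hom G bG"
    and dense: "T closure_of (\<eta> ` carrier G) = carrier bG"
    and small: "\<And>(K :: 'a set set monoid) S f. compact_hausdorff_group K S \<Longrightarrow> f \<in> hom G K \<Longrightarrow>
      \<exists>g \<in> hom bG K. continuous_map T S g \<and> (\<forall>x \<in> carrier G. g (\<eta> x) = f x)"
    and K: "compact_hausdorff_group K S"
  shows "factors_uniquely G bG T \<eta> K S"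
  unfolding factors_uniquely_def
proof
  fix f assume f: "f \<in> hom G K"
  interpret G: group G by fact
  interpret bG: compact_hausdorff_group bG T by fact
  interpret K: compact_hausdorff_group K S by fact
  obtain L :: "'a set set monoid" and R f' h
    where L: "compact_hausdorff_group L R" "f' \<in> hom G L" "h \<in> hom L K" "continuous_map R S h"
      "\<And>x. x \<in> carrier G \<Longrightarrow> h (f' x) = f x"
    using compact_hausdorff_group_small[OF \<open>group G\<close> K f] by metis
  from small[OF L(1,2)] obtain g where g: "g \<in> hom bG L" "continuous_map T R g"
    "\<And>x. x \<in> carrier G \<Longrightarrow> g (\<eta> x) = f' x" by blast
  let ?g = "restrict (h \<circ> g) (carrier bG)"
  show "\<exists>!g. g \<in> hom bG K \<and> g \<in> extensional (carrier bG) \<and>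
        continuous_map T S g \<and> (\<forall>x \<in> carrier G. g (\<eta> x) = f x)"
  proof (rule ex1I[of _ ?g], intro conjI ballI)
    have "h \<circ> g \<in> hom bG K" using hom_compose[OF g(1) L(3)] .
    then show "?g \<in> hom bG K" by (auto simp: hom_def Pi_iff)
    show "?g \<in> extensional (carrier bG)" by simp
    have "continuous_map T S (h \<circ> g)" using continuous_map_compose[OF g(2) L(4)] .
    then show "continuous_map T S ?g" by (rule continuous_map_eq) (simp add: bG.topspace_eq)
    show "?g (\<eta> x) = f x" if "x \<in> carrier G" for x
      using that eta g(3) L(5) by (auto simp: hom_def Pi_iff)
  next
    fix g' assume g': "g' \<in> hom bG K \<and> g' \<in> extensional (carrier bG) \<and>
        continuous_map T S g' \<and> (\<forall>x \<in> carrier G. g' (\<eta> x) = f x)"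
    have c: "continuous_map T S ?g"
      by (rule continuous_map_eq[OF continuous_map_compose[OF g(2) L(4)]]) (simp add: bG.topspace_eq)
    have gf: "?g (\<eta> x) = f x" if "x \<in> carrier G" for x
      using that eta g(3) L(5) by (auto simp: hom_def Pi_iff)
    show "g' = ?g"
    proof (rule extensionalityI)
      fix x assume "x \<in> carrier bG"
      then have "x \<in> T closure_of (\<eta> ` carrier G)" using dense by simp
      then show "g' x = ?g x"
      proof (rule forall_in_closure_of_eq[OF _ K.Hausdorff _ c])
        show "g' y = ?g y" if "y \<in> \<eta> ` carrier G" for y using that g' gf by force
      qed (use g' in blast)
    qed (use g' in auto)
  qed
qed

lemma bohr_compactification_dense:
  fixes G :: "('a, 'm) monoid_scheme" and bG :: "'b monoid"
  assumes "group G" and b: "bohr_compactification G bG T \<eta>"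
  shows "T closure_of (\<eta> ` carrier G) = carrier bG"
proof -
  have bG: "compact_hausdorff_group bG T" and eta: "\<eta> \<in> hom G bG"
    and univ: "\<And>(K :: 'b monoid) S. compact_hausdorff_group K S \<Longrightarrow> factors_uniquely G bG T \<eta> K S"
    using b by (auto simp: bohr_compactification_def)
  interpret G: group G by fact
  interpret bG: compact_hausdorff_group bG T by fact
  interpret eta: group_hom G bG \<eta> by unfold_locales (fact eta)
  let ?C = "T closure_of (\<eta> ` carrier G)"
  have H: "subgroup (\<eta> ` carrier G) bG" by (rule eta.img_is_subgroup)
  have HC: "\<eta> ` carrier G \<subseteq> ?C" by (rule closure_of_subset) (simp add: bG.topspace_eq subgroup.subset[OF H])
  have CG: "?C \<subseteq> carrier bG" using closure_of_subset_topspace[of T] by (simp add: bG.topspace_eq)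
  note C = compact_hausdorff_group_closure(2)[OF bG H]
  have "\<eta> \<in> hom G (bG\<lparr>carrier := ?C\<rparr>)" using eta HC by (auto simp: hom_def)
  then obtain r where r: "r \<in> hom bG (bG\<lparr>carrier := ?C\<rparr>)" "r \<in> extensional (carrier bG)"
    "continuous_map T (subtopology T ?C) r" "\<forall>x \<in> carrier G. r (\<eta> x) = \<eta> x"
    using univ[OF C] unfolding factors_uniquely_def by blast
  let ?i = "restrict id (carrier bG)"
  define Q where "Q g \<longleftrightarrow> g \<in> hom bG bG \<and> g \<in> extensional (carrier bG) \<and>
        continuous_map T T g \<and> (\<forall>x \<in> carrier G. g (\<eta> x) = \<eta> x)" for g
  have "\<exists>!g. Q g" using univ[OF bG] eta unfolding factors_uniquely_def Q_def by (rule bspec)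
  moreover have "Q r"
    using r CG by (auto simp: Q_def continuous_map_in_subtopology hom_def Pi_iff)
  moreover have "Q ?i"
  proof -
    have "continuous_map T T ?i"
      by (rule continuous_map_eq[OF continuous_map_id]) (simp add: bG.topspace_eq)
    then show ?thesis by (simp add: Q_def hom_def)
  qed
  ultimately have "r = ?i" by blast
  have "x \<in> ?C" if x: "x \<in> carrier bG" for x
  proof -
    have "r x \<in> ?C" using hom_in_carrier[OF r(1) x] by simp
    moreover have "r x = x" using \<open>r = ?i\<close> x by simp
    ultimately show ?thesis by simp
  qed
  then show ?thesis using CG by blast
qed

theorem bohr_compactification_universal:
  fixes G :: "('a, 'm) monoid_scheme" and bG :: "'b monoid" and K :: "('k, 'l) monoid_scheme"
  assumes "group G" and b: "bohr_compactification G bG T \<eta>" and "compact_hausdorff_group K S"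
  shows "factors_uniquely G bG T \<eta> K S"
proof (rule factors_uniquely_if_dense[OF \<open>group G\<close> _ _ bohr_compactification_dense[OF assms(1,2)] _ assms(3)])
  show "\<exists>g \<in> hom bG K. continuous_map T S g \<and> (\<forall>x \<in> carrier G. g (\<eta> x) = f x)"
    if "compact_hausdorff_group K S" "f \<in> hom G K" for K :: "'a set set monoid" and S f
  proof -
    have "factors_uniquely G bG T \<eta> K S"
      using b that(1) by (simp add: bohr_compactification_def)
    then show ?thesis
      unfolding factors_uniquely_def using that(2) by (fast dest: bspec)
  qed
qed (use b in \<open>auto simp: bohr_compactification_def\<close>)


section \<open>Existence of the Bohr compactification\<close>

lemma compact_hausdorff_group_product:
  assumes "\<And>i. i \<in> I \<Longrightarrow> compact_hausdorff_group (K i) (S i)"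
  shows "compact_hausdorff_group (product_group I K) (product_topology S I)"
proof -
  have grp: "group (K i)" if "i \<in> I" for i
    using assms[OF that] by (simp add: compact_hausdorff_group_def)
  have ts: "topspace (S i) = carrier (K i)" if "i \<in> I" for i
    using compact_hausdorff_group.topspace_eq[OF assms[OF that]] .
  interpret P: group "product_group I K" using grp by simp
  have tP: "topspace (product_topology S I) = carrier (product_group I K)"
    by (auto simp: ts PiE_iff)
  have proj: "continuous_map (product_topology S I) (S i) (\<lambda>x. x i)" if "i \<in> I" for i
    using that by (rule continuous_map_product_projection)
  show ?thesis
  proof
    show "topspace (product_topology S I) = carrier (product_group I K)" by (rule tP)
    show "compact_space (product_topology S I)"
      using compact_hausdorff_group.compact[OF assms] by (simp add: compact_space_product_topology)
    show "Hausdorff_space (product_topology S I)"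
      using compact_hausdorff_group.Hausdorff[OF assms] by (simp add: Hausdorff_space_product_topology)
    show "continuous_map (prod_topology (product_topology S I) (product_topology S I))
        (product_topology S I) (\<lambda>(x, y). x \<otimes>\<^bsub>product_group I K\<^esub> y)"
      unfolding continuous_map_componentwise
    proof (intro conjI ballI)
      fix i assume i: "i \<in> I"
      have "continuous_map (prod_topology (product_topology S I) (product_topology S I))
          (prod_topology (S i) (S i)) (\<lambda>(x, y). (x i, y i))"
        using proj[OF i] by (simp add: continuous_map_prod_top)
      from continuous_map_compose[OF this compact_hausdorff_group.continuous_mult[OF assms[OF i]]]
      show "continuous_map (prod_topology (product_topology S I) (product_topology S I)) (S i)
          (\<lambda>k. (case k of (x, y) \<Rightarrow> x \<otimes>\<^bsub>product_group I K\<^esub> y) i)"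
        by (rule continuous_map_eq) (use i in auto)
    qed auto
    show "continuous_map (product_topology S I) (product_topology S I) (\<lambda>x. inv\<^bsub>product_group I K\<^esub> x)"
      unfolding continuous_map_componentwise
    proof (intro conjI ballI)
      have "inv\<^bsub>product_group I K\<^esub> x \<in> extensional I" if "x \<in> carrier (product_group I K)" for x
        using P.inv_closed[OF that] by (simp add: PiE_iff)
      then show "(\<lambda>x. inv\<^bsub>product_group I K\<^esub> x) ` topspace (product_topology S I) \<subseteq> extensional I"
        unfolding tP by blast
      fix i assume i: "i \<in> I"
      from continuous_map_compose[OF proj[OF i] compact_hausdorff_group.continuous_inv[OF assms[OF i]]]
      show "continuous_map (product_topology S I) (S i) (\<lambda>x. (inv\<^bsub>product_group I K\<^esub> x) i)"
        by (rule continuous_map_eq) (use i grp ts in \<open>auto simp: inv_product_group PiE_iff\<close>)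
    qed
  qed
qed

theorem bohr_compactification_exists:
  fixes G :: "('a, 'm) monoid_scheme"
  assumes "group G"
  shows "\<exists>(bG :: ('a set set monoid \<times> 'a set set topology \<times> ('a \<Rightarrow> 'a set set) \<Rightarrow> 'a set set) monoid) T \<eta>.
    bohr_compactification G bG T \<eta>"
proof -
  interpret G: group G by fact
  define I :: "('a set set monoid \<times> 'a set set topology \<times> ('a \<Rightarrow> 'a set set)) set"
    where "I = {(K, S, f). compact_hausdorff_group K S \<and> f \<in> hom G K}"
  let ?P = "product_group I fst"
  let ?T = "product_topology (\<lambda>i. fst (snd i)) I"
  define \<eta> where "\<eta> x = (\<lambda>i\<in>I. snd (snd i) x)" for x
  have P: "compact_hausdorff_group ?P ?T"
    by (rule compact_hausdorff_group_product) (auto simp: I_def)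
  interpret P: compact_hausdorff_group ?P ?T by (rule P)
  have eta: "\<eta> \<in> hom G ?P"
  proof (rule homI)
    have c: "snd (snd i) \<in> hom G (fst i)" if "i \<in> I" for i using that by (auto simp: I_def)
    show "\<eta> x \<in> carrier ?P" if "x \<in> carrier G" for x
      using hom_in_carrier[OF c that] by (simp add: \<eta>_def)
    show "\<eta> (x \<otimes>\<^bsub>G\<^esub> y) = \<eta> x \<otimes>\<^bsub>?P\<^esub> \<eta> y" if "x \<in> carrier G" "y \<in> carrier G" for x y
      using hom_mult[OF c that] by (auto simp: \<eta>_def intro: restrict_ext)
  qed
  interpret eta: group_hom G ?P \<eta> by unfold_locales (fact eta)
  let ?H = "\<eta> ` carrier G"
  let ?C = "?T closure_of ?H"
  let ?bG = "?P\<lparr>carrier := ?C\<rparr>"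
  let ?bT = "subtopology ?T ?C"
  have H: "subgroup ?H ?P" by (rule eta.img_is_subgroup)
  have HC: "?H \<subseteq> ?C" by (rule closure_of_subset) (use P.topspace_eq subgroup.subset[OF H] in simp)
  have CP: "?C \<subseteq> carrier ?P" using closure_of_subset_topspace[of ?T ?H] P.topspace_eq by simp
  have bG: "compact_hausdorff_group ?bG ?bT" by (rule compact_hausdorff_group_closure[OF P H])
  have eta': "\<eta> \<in> hom G ?bG" using eta HC by (auto simp: hom_def)
  have dense: "?bT closure_of ?H = carrier ?bG"
    using HC by (simp add: closure_of_subtopology Int_absorb1)
  have small: "\<exists>g \<in> hom ?bG K. continuous_map ?bT S g \<and> (\<forall>x \<in> carrier G. g (\<eta> x) = f x)"
    if "compact_hausdorff_group K S" "f \<in> hom G K" for K :: "'a set set monoid" and S f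
  proof (intro bexI conjI ballI)
    have i: "(K, S, f) \<in> I" using that by (simp add: I_def)
    show "(\<lambda>x. x (K, S, f)) \<in> hom ?bG K"
      using CP i by (fastforce simp: hom_def PiE_iff)
    show "continuous_map ?bT S (\<lambda>x. x (K, S, f))"
      using continuous_map_product_projection[OF i, of "\<lambda>i. fst (snd i)"]
      by (simp add: continuous_map_from_subtopology)
    show "\<eta> x (K, S, f) = f x" for x using i by (simp add: \<eta>_def)
  qed
  have "bohr_compactification G ?bG ?bT \<eta>"
    unfolding bohr_compactification_def
    by (intro conjI allI impI bG eta' factors_uniquely_if_dense[OF \<open>group G\<close> bG eta' dense small])
  then show ?thesis by blast
qed

end

theory Submission
  imports Defs
begin

text \<open>
  Why the theorem holds. Positive density \<open>sigma_R G A > 0\<close> together with amenability yields a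
  left-invariant mean \<open>\<mu>\<close> with \<open>\<mu> A > 0\<close>, and likewise a left-invariant mean \<open>\<nu>\<close> with
  \<open>\<nu> B > 0\<close>. The translates of \<open>B\<close> are correlated through the positive semidefinite kernel
  \<open>\<kappa> a b = \<nu> (a B \<inter> b B)\<close>, and \<open>\<kappa> a b \<noteq> 0\<close> puts \<open>b\<^sup>-\<^sup>1 a\<close> into \<open>B B\<^sup>-\<^sup>1\<close>. Averaging the
  kernel over a translate of \<open>A\<close> gives the function
  \<open>F g = \<integral> 1\<^sub>A (g\<^sup>-\<^sup>1 a) \<kappa> a b d\<mu>(a)\<close>, with a fixed base point \<open>b \<in> A\<close>. If \<open>F g > 0\<close>, then
  some \<open>a \<in> g A\<close> has \<open>a B \<inter> b B \<noteq> {}\<close>, and solving for \<open>g\<close> shows \<open>g \<in> A B B\<^sup>-\<^sup>1 A\<^sup>-\<^sup>1\<close>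
  (\<open>smoothed_positive_imp_product\<close>). So it suffices that \<open>F\<close> is Bohr continuous and positive at
  the unit.

  Bohr continuity follows from a compactness principle for means: with \<open>\<xi> a = 1\<^sub>B (a\<^sup>-\<^sup>1 \<cdot>)\<close>,
  the map sending \<open>f\<close> to \<open>b \<mapsto> \<integral> f a \<kappa> a b d\<mu>(a)\<close> is a Hilbert-Schmidt type operator, because Bessel's
  inequality bounds \<open>\<Sum>e. \<integral> \<langle>\<xi> a, e\<rangle>\<^sup>2 d\<mu>(a)\<close> by 1 for every orthonormal family of vectors \<open>e\<close>.
  Hence up to a uniformly small error it has finite rank (\<open>mean_kernel_finite_rank\<close>). By
  invariance of \<open>\<mu>\<close> and \<open>\<nu>\<close>, the left translates of \<open>F\<close> only move the base point \<open>b\<close>, so \<open>F\<close>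
  is almost periodic (\<open>smoothed_almost_periodic\<close>). An almost periodic function is continuous for
  a bi-invariant precompact pseudometric; the completion of \<open>G\<close> in this pseudometric is a
  compact group, to which the universal property of the Bohr compactification applies
  (\<open>almost_periodic_bohr_continuous\<close>).

  Positivity at the unit holds for a suitable \<open>b \<in> A\<close> because the translates \<open>a B\<close> all have
  mean \<open>\<nu> B > 0\<close>, so only boundedly many of them can be pairwise almost uncorrelated
  (\<open>positive_correlation\<close>).

  The invariant means come from Foelner sets: translating a Foelner set \<open>F\<close> on the right keeps it
  almost left-invariant, and the definition of \<open>sigma_R\<close> provides a translate in which \<open>A\<close> has
  relative density bounded below; a cluster point of the averages over such sets is the mean
  (\<open>invariant_mean_positive\<close>). Foelner sets exist because otherwise a finite set \<open>L\<close> would at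
  least double every finite set, and Hall's marriage theorem would turn this into a paradoxical
  decomposition of \<open>G\<close>, which an invariant finitely additive measure excludes.
\<close>

section \<open>Hall's marriage theorem for infinite families\<close>

text \<open>
  Rado's argument. Zorn's lemma gives a maximal set \<open>M\<close> of edges whose removal preserves Hall's
  condition; finiteness of the sets \<open>N x\<close> makes the condition, for a given finite \<open>X\<close>, depend on
  finitely many edges only, so chains have upper bounds. In the remaining graph \<open>R\<close> every
  element of \<open>I\<close> has exactly one edge: if \<open>x\<close> kept two neighbours, deleting either of them would break the
  condition, and the two tight sets that witness this contradict Hall's condition for their union
  and intersection.
\<close>
lemma hall_infinite:
  fixes N :: "'x \<Rightarrow> 'y set"
  assumes fin: "\<And>x. x \<in> I \<Longrightarrow> finite (N x)"
    and hall: "\<And>X. X \<subseteq> I \<Longrightarrow> finite X \<Longrightarrow> card X \<le> card (\<Union> (N ` X))"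
  shows "\<exists>\<phi>. inj_on \<phi> I \<and> (\<forall>x\<in>I. \<phi> x \<in> N x)"
proof -
  define E where "E = Sigma I N"
  define good where "good D \<longleftrightarrow> (\<forall>X. X \<subseteq> I \<longrightarrow> finite X \<longrightarrow> card X \<le> card ((E - D) `` X))" for D
  have finE: "finite (E \<inter> X \<times> UNIV)" if "X \<subseteq> I" "finite X" for X
  proof (rule finite_subset)
    show "E \<inter> X \<times> UNIV \<subseteq> Sigma X N" by (auto simp: E_def)
    show "finite (Sigma X N)" using that fin by (intro finite_SigmaI) auto
  qed
  have fin_img: "finite ((E - D) `` X)" if "X \<subseteq> I" "finite X" for X D
  proof (rule finite_subset)
    show "(E - D) `` X \<subseteq> Range (E \<inter> X \<times> UNIV)" by auto
    show "finite (Range (E \<inter> X \<times> UNIV))" using finE[OF that] by (rule finite_Range)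
  qed
  have "good {}"
    unfolding good_def
  proof (intro allI impI)
    fix X assume X: "X \<subseteq> I" "finite X"
    then have "(E - {}) `` X = \<Union> (N ` X)" by (auto simp: E_def)
    with hall[OF X] show "card X \<le> card ((E - {}) `` X)" by simp
  qed
  have "\<exists>M\<in>{D. good D}. \<forall>D\<in>{D. good D}. M \<subseteq> D \<longrightarrow> D = M"
  proof (rule subset_Zorn_nonempty)
    show "{D. good D} \<noteq> {}" using \<open>good {}\<close> by auto
    fix \<C> assume \<C>: "\<C> \<noteq> {}" "subset.chain {D. good D} \<C>"
    have "good (\<Union>\<C>)"
      unfolding good_def
    proof (intro allI impI)
      fix X assume X: "X \<subseteq> I" "finite X"
      let ?F = "E \<inter> X \<times> UNIV \<inter> \<Union>\<C>"
      have "finite ?F" using finE[OF X] by blast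
      moreover have "?F \<subseteq> \<Union>\<C>" by blast
      ultimately obtain D where D: "D \<in> \<C>" "?F \<subseteq> D"
        using \<C> finite_subset_Union_chain by metis
      then have "(E - \<Union>\<C>) `` X = (E - D) `` X" by blast
      moreover have "good D" using D(1) \<C>(2) by (auto simp: subset_chain_def)
      ultimately show "card X \<le> card ((E - \<Union>\<C>) `` X)" using X by (simp add: good_def)
    qed
    then show "\<Union>\<C> \<in> {D. good D}" by simp
  qed
  then obtain M where M: "good M" and max: "\<And>D. good D \<Longrightarrow> M \<subseteq> D \<Longrightarrow> D = M" by blast
  define R where "R = E - M"
  have R: "card X \<le> card (R `` X)" if "X \<subseteq> I" "finite X" for X
    using M that by (auto simp: good_def R_def)
  have finR: "finite (R `` X)" if "X \<subseteq> I" "finite X" for X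
    using fin_img[OF that] by (simp add: R_def)
  have tight: "\<exists>X'. X' \<subseteq> I \<and> finite X' \<and> x \<notin> X' \<and> card (R `` X' \<union> (R `` {x} - {u})) \<le> card X'"
    if "x \<in> I" "(x, u) \<in> R" for x u
  proof -
    have "\<not> good (insert (x, u) M)"
      using max[of "insert (x, u) M"] that by (auto simp: R_def)
    moreover have "E - insert (x, u) M = R - {(x, u)}" by (auto simp: R_def)
    ultimately obtain X where X: "X \<subseteq> I" "finite X" "card ((R - {(x, u)}) `` X) < card X"
      by (auto simp: good_def not_le)
    have x: "x \<in> X"
    proof (rule ccontr)
      assume "x \<notin> X"
      then have "(R - {(x, u)}) `` X = R `` X" by auto
      with X R[OF X(1,2)] show False by simp
    qed
    have "R `` (X - {x}) \<union> (R `` {x} - {u}) = (R - {(x, u)}) `` X" using x by auto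
    moreover have "card X = Suc (card (X - {x}))" using card_Suc_Diff1[OF X(2) x] by simp
    ultimately show ?thesis using X by (intro exI[of _ "X - {x}"]) auto
  qed
  have single: "u = v" if x: "x \<in> I" and uv: "(x, u) \<in> R" "(x, v) \<in> R" for x u v
  proof (rule ccontr)
    assume "u \<noteq> v"
    obtain X Y where X: "X \<subseteq> I" "finite X" "x \<notin> X" "card (R `` X \<union> (R `` {x} - {u})) \<le> card X"
      and Y: "Y \<subseteq> I" "finite Y" "x \<notin> Y" "card (R `` Y \<union> (R `` {x} - {v})) \<le> card Y"
      using tight[OF x uv(1)] tight[OF x uv(2)] by blast
    let ?P = "R `` X \<union> (R `` {x} - {u})" and ?Q = "R `` Y \<union> (R `` {x} - {v})"
    have fP: "finite ?P" "finite ?Q" using finR X Y x by auto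
    \<comment> \<open>Counting \<open>?P\<close> and \<open>?Q\<close> by inclusion and exclusion: the union already sees \<open>x\<close>.\<close>
    have "?P \<union> ?Q = R `` (insert x (X \<union> Y))" using \<open>u \<noteq> v\<close> by auto
    then have 1: "Suc (card (X \<union> Y)) \<le> card (?P \<union> ?Q)"
      using R[of "insert x (X \<union> Y)"] X Y x by simp
    have "R `` (X \<inter> Y) \<subseteq> ?P \<inter> ?Q" by auto
    then have 2: "card (X \<inter> Y) \<le> card (?P \<inter> ?Q)"
      using R[of "X \<inter> Y"] X Y fP card_mono[of "?P \<inter> ?Q" "R `` (X \<inter> Y)"] by force
    show False
      using 1 2 card_Un_Int[OF fP] card_Un_Int[OF X(2) Y(2)] X(4) Y(4) by linarith
  qed
  have ex: "\<exists>u. (x, u) \<in> R" if "x \<in> I" for x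
    using R[of "{x}"] that by (cases "R `` {x} = {}") auto
  define \<phi> where "\<phi> x = (SOME u. (x, u) \<in> R)" for x
  have \<phi>: "(x, \<phi> x) \<in> R" if "x \<in> I" for x
    unfolding \<phi>_def using ex[OF that] by (rule someI_ex)
  show ?thesis
  proof (intro exI[of _ \<phi>] conjI ballI)
    show "\<phi> x \<in> N x" if "x \<in> I" for x using \<phi>[OF that] by (auto simp: R_def E_def)
    show "inj_on \<phi> I"
    proof (rule inj_onI, rule ccontr)
      fix x y assume xy: "x \<in> I" "y \<in> I" "\<phi> x = \<phi> y" "x \<noteq> y"
      have "R `` {x, y} \<subseteq> {\<phi> x}"
      proof
        fix u assume "u \<in> R `` {x, y}"
        then have "u = \<phi> x \<or> u = \<phi> y"
          using single[OF xy(1) _ \<phi>[OF xy(1)], of u] single[OF xy(2) _ \<phi>[OF xy(2)], of u] by blast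
        then show "u \<in> {\<phi> x}" using xy(3) by simp
      qed
      then have "card (R `` {x, y}) \<le> card {\<phi> x}" by (rule card_mono[rotated]) simp
      moreover have "card {x, y} = 2" using xy(4) by simp
      moreover have "card {x, y} \<le> card (R `` {x, y})" by (rule R) (use xy(1,2) in auto)
      ultimately show False by simp
    qed
  qed
qed

section \<open>Foelner sets\<close>

lemma additive_Pow_sum:
  fixes \<mu> :: "'a set \<Rightarrow> real"
  assumes add: "additive (Pow \<Omega>) \<mu>" and "finite I"
    and "disjoint_family_on A I" and "\<And>i. i \<in> I \<Longrightarrow> A i \<subseteq> \<Omega>"
  shows "\<mu> (\<Union>i\<in>I. A i) = (\<Sum>i\<in>I. \<mu> (A i))"
  using assms(2-)
proof (induction I rule: finite_induct)
  case empty
  show ?case using additiveD[OF add, of "{}" "{}"] by simp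
next
  case (insert i I)
  have "\<mu> (A i \<union> (\<Union>j\<in>I. A j)) = \<mu> (A i) + \<mu> (\<Union>j\<in>I. A j)"
    using insert.prems insert.hyps by (intro additiveD[OF add]) (auto simp: disjoint_family_on_def)
  moreover have "\<mu> (\<Union>j\<in>I. A j) = (\<Sum>j\<in>I. \<mu> (A j))"
    using insert.prems by (intro insert.IH) (auto simp: disjoint_family_on_def)
  ultimately show ?case using insert.hyps by simp
qed

text \<open>
  If \<open>L\<close> doubled every finite set, Hall's theorem would match two copies of \<open>G\<close> (indexed by
  \<^typ>\<open>bool\<close>) injectively into one copy, moving each point by some element of \<open>L\<close>. Each copy is
  cut into finitely many pieces that are moved by one left translation each, so both images have
  measure 1, although they are disjoint.
\<close>
lemma amenable_small_doubling:
  fixes G :: "('a, 'm) monoid_scheme" (structure)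
  assumes "amenable_group G" and L: "L \<subseteq> carrier G" "finite L"
  obtains F where "F \<subseteq> carrier G" "finite F" "F \<noteq> {}" "card (L <#> F) < 2 * card F"
proof (rule ccontr)
  interpret group G using assms(1) by (simp add: amenable_group_def)
  obtain \<mu> :: "'a set \<Rightarrow> real" where pos: "\<And>A. A \<subseteq> carrier G \<Longrightarrow> 0 \<le> \<mu> A"
    and one: "\<mu> (carrier G) = 1" and add: "additive (Pow (carrier G)) \<mu>"
    and inv: "\<And>x A. x \<in> carrier G \<Longrightarrow> A \<subseteq> carrier G \<Longrightarrow> \<mu> (x <#\<^bsub>G\<^esub> A) = \<mu> A"
    using assms(1) unfolding amenable_group_def by blast
  note found = that
  assume no: "\<not> thesis"
  have dbl: "2 * card F \<le> card (L <#> F)" if "F \<subseteq> carrier G" "finite F" for F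
    using that no found[of F] by (cases "F = {}") (auto simp: not_le)
  define N where "N p = (\<lambda>k. k \<otimes> fst p) ` L" for p :: "'a \<times> bool"
  have finN: "finite (N p)" for p using L(2) by (simp add: N_def)
  have hall: "card X \<le> card (\<Union> (N ` X))" if X: "X \<subseteq> carrier G \<times> UNIV" "finite X" for X
  proof -
    have "card X \<le> card (fst ` X \<times> (UNIV :: bool set))"
      using X by (intro card_mono) (auto intro: rev_image_eqI)
    also have "\<dots> = 2 * card (fst ` X)" by (simp add: card_cartesian_product)
    also have "\<dots> \<le> card (L <#> fst ` X)" using X by (intro dbl) auto
    also have "L <#> fst ` X = \<Union> (N ` X)" by (auto simp: set_mult_def N_def)
    finally show ?thesis .
  qed
  obtain \<phi> where inj: "inj_on \<phi> (carrier G \<times> UNIV)" and \<phi>: "\<forall>p\<in>carrier G \<times> UNIV. \<phi> p \<in> N p"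
    using hall_infinite[OF finN hall] by blast
  define im where "im i = (\<lambda>x. \<phi> (x, i)) ` carrier G" for i :: bool
  have ex: "\<exists>k\<in>L. \<phi> (x, i) = k \<otimes> x" if "x \<in> carrier G" for x i
    using bspec[OF \<phi>, of "(x, i)"] that by (auto simp: N_def)
  have im_sub: "im i \<subseteq> carrier G" for i
    unfolding im_def
  proof (rule image_subsetI)
    fix x assume x: "x \<in> carrier G"
    then obtain k where "k \<in> L" "\<phi> (x, i) = k \<otimes> x" using ex by blast
    then show "\<phi> (x, i) \<in> carrier G" using x subsetD[OF L(1)] by simp
  qed
  have im_measure: "\<mu> (im i) = 1" for i
  proof -
    define P where "P k = {x \<in> carrier G. \<phi> (x, i) = k \<otimes> x}" for k
    have P: "P k \<subseteq> carrier G" for k by (auto simp: P_def)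
    have im_P: "k <#\<^bsub>G\<^esub> P k = (\<lambda>x. \<phi> (x, i)) ` P k" for k
      by (auto simp: l_coset_def P_def)
    have disj: "disjoint_family_on P L"
      unfolding disjoint_family_on_def
    proof (intro ballI impI)
      fix k l assume "k \<in> L" "l \<in> L" "k \<noteq> l"
      then have "k \<otimes> x \<noteq> l \<otimes> x" if "x \<in> carrier G" for x
        using that subsetD[OF L(1)] right_cancel by blast
      then show "P k \<inter> P l = {}" unfolding P_def by force
    qed
    have cover: "(\<Union>k\<in>L. P k) = carrier G"
      unfolding P_def using ex by blast
    have "\<mu> (im i) = \<mu> (\<Union>k\<in>L. k <#\<^bsub>G\<^esub> P k)"
      by (simp only: im_def im_P cover[symmetric] image_UN)
    also have "\<dots> = (\<Sum>k\<in>L. \<mu> (k <#\<^bsub>G\<^esub> P k))"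
    proof (rule additive_Pow_sum[OF add L(2)])
      show "disjoint_family_on (\<lambda>k. k <#\<^bsub>G\<^esub> P k) L"
        unfolding disjoint_family_on_def im_P
      proof (intro ballI impI)
        fix k l assume kl: "k \<in> L" "l \<in> L" "k \<noteq> l"
        have "inj_on (\<lambda>x. \<phi> (x, i)) (carrier G)"
          using inj by (auto simp: inj_on_def)
        moreover have "P k \<inter> P l = {}" using disj kl by (simp add: disjoint_family_on_def)
        ultimately show "(\<lambda>x. \<phi> (x, i)) ` P k \<inter> (\<lambda>x. \<phi> (x, i)) ` P l = {}"
          using inj_on_image_Int[OF _ P P] by (metis image_empty)
      qed
      show "k <#\<^bsub>G\<^esub> P k \<subseteq> carrier G" if "k \<in> L" for k
        using that L(1) P by (intro l_coset_subset_G) auto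
    qed
    also have "\<dots> = (\<Sum>k\<in>L. \<mu> (P k))"
      using L(1) P inv by (intro sum.cong) auto
    also have "\<dots> = \<mu> (\<Union>k\<in>L. P k)"
      using additive_Pow_sum[OF add L(2) disj] P by simp
    also have "\<dots> = 1" by (simp only: cover one)
    finally show ?thesis .
  qed
  have disj: "im True \<inter> im False = {}"
    unfolding im_def using inj_onD[OF inj] by force
  have "\<mu> (carrier G) = \<mu> (im True \<union> im False) + \<mu> (carrier G - (im True \<union> im False))"
    using im_sub additiveD[OF add, of "im True \<union> im False" "carrier G - (im True \<union> im False)"]
    by (simp add: Un_absorb1)
  moreover have "\<mu> (im True \<union> im False) = \<mu> (im True) + \<mu> (im False)"
    using im_sub disj by (intro additiveD[OF add]) auto
  moreover have "0 \<le> \<mu> (carrier G - (im True \<union> im False))" by (rule pos) auto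
  ultimately show False using one im_measure by simp
qed

text \<open>
  Without a Foelner set, multiplication by \<open>insert \<one> K\<close> would enlarge every finite set by the factor
  \<open>1 + \<epsilon>\<close>; sufficiently many iterations would double every finite set.
\<close>
lemma amenable_folner:
  fixes G :: "('a, 'm) monoid_scheme" (structure)
  assumes am: "amenable_group G" and K: "K \<subseteq> carrier G" "finite K" and "\<epsilon> > 0"
  obtains F where "F \<subseteq> carrier G" "finite F" "F \<noteq> {}"
    "\<And>k. k \<in> K \<Longrightarrow> real (card ((k <#\<^bsub>G\<^esub> F) - F)) \<le> \<epsilon> * real (card F)"
proof (rule ccontr)
  interpret group G using am by (simp add: amenable_group_def)
  note found = that
  assume "\<not> thesis"
  then have no: "\<exists>k\<in>K. \<epsilon> * real (card F) < real (card ((k <#\<^bsub>G\<^esub> F) - F))"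
    if "F \<subseteq> carrier G" "finite F" "F \<noteq> {}" for F
    using that found[of F] by (meson not_le)
  define K1 where "K1 = insert \<one> K"
  define L where "L n = ((\<lambda>X. K1 <#> X) ^^ n) {\<one>}" for n
  have K1: "K1 \<subseteq> carrier G" "finite K1" using K by (auto simp: K1_def)
  have fin_mult: "finite (X <#> Y)" if "finite X" "finite Y" for X Y :: "'a set"
    using that by (auto simp: set_mult_def)
  have L0: "L 0 = {\<one>}" and LS: "L (Suc n) = K1 <#> L n" for n by (simp_all add: L_def)
  have L: "L n \<subseteq> carrier G \<and> finite (L n)" for n
    by (induction n) (use K1 set_mult_closed fin_mult in \<open>auto simp: L0 LS\<close>)
  have step: "(1 + \<epsilon>) * real (card F) \<le> real (card (K1 <#> F))"
    if F: "F \<subseteq> carrier G" "finite F" for F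
  proof (cases "F = {}")
    case False
    then obtain k where k: "k \<in> K" "\<epsilon> * real (card F) < real (card ((k <#\<^bsub>G\<^esub> F) - F))"
      using no F by blast
    have "\<one> \<otimes> x = x" if "x \<in> F" for x using F(1) that by auto
    then have "F \<union> ((k <#\<^bsub>G\<^esub> F) - F) \<subseteq> K1 <#> F"
      using k(1) by (force simp: set_mult_def l_coset_def K1_def)
    then have "card (F \<union> ((k <#\<^bsub>G\<^esub> F) - F)) \<le> card (K1 <#> F)"
      by (rule card_mono[rotated]) (rule fin_mult[OF K1(2) F(2)])
    moreover have "finite (k <#\<^bsub>G\<^esub> F)" using F(2) by (auto simp: l_coset_def)
    then have "card (F \<union> ((k <#\<^bsub>G\<^esub> F) - F)) = card F + card ((k <#\<^bsub>G\<^esub> F) - F)"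
      using F(2) by (intro card_Un_disjoint) auto
    ultimately show ?thesis using k(2) by (simp add: algebra_simps)
  qed simp
  have grow: "(1 + \<epsilon>) ^ n * real (card F) \<le> real (card (L n <#> F))"
    if F: "F \<subseteq> carrier G" "finite F" for F n
  proof (induction n)
    case 0
    have "L 0 <#> F = F" using F(1) by (force simp: set_mult_def L0)
    then show ?case by simp
  next
    case (Suc n)
    have "(1 + \<epsilon>) ^ Suc n * real (card F) \<le> (1 + \<epsilon>) * real (card (L n <#> F))"
      using Suc \<open>\<epsilon> > 0\<close> by (simp add: mult.assoc)
    also have "\<dots> \<le> real (card (K1 <#> (L n <#> F)))"
      using L[of n] F by (intro step set_mult_closed fin_mult) auto
    also have "K1 <#> (L n <#> F) = L (Suc n) <#> F"
      using K1 L[of n] F by (simp add: LS set_mult_assoc)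
    finally show ?case .
  qed
  obtain n where n: "2 < (1 + \<epsilon>) ^ n" using real_arch_pow[of "1 + \<epsilon>" 2] \<open>\<epsilon> > 0\<close> by auto
  obtain F where F: "F \<subseteq> carrier G" "finite F" "F \<noteq> {}" "card (L n <#> F) < 2 * card F"
    using amenable_small_doubling[OF am] L[of n] by metis
  have "2 * real (card F) \<le> (1 + \<epsilon>) ^ n * real (card F)" using n by (intro mult_right_mono) auto
  then show False using grow[OF F(1,2), of n] F(4) by linarith
qed

section \<open>Invariant means\<close>

text \<open>
  Means are modelled as functionals on all functions, but only their values on functions bounded on
  \<open>X\<close> carry information.
\<close>
definition bounded_funs :: "'a set \<Rightarrow> ('a \<Rightarrow> real) set" where
  "bounded_funs X = {f. \<exists>C. \<forall>x\<in>X. \<bar>f x\<bar> \<le> C}"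

lemma bounded_funsI: "(\<And>x. x \<in> X \<Longrightarrow> \<bar>f x\<bar> \<le> C) \<Longrightarrow> f \<in> bounded_funs X"
  by (auto simp: bounded_funs_def)

lemma bounded_funs_add: "f \<in> bounded_funs X \<Longrightarrow> g \<in> bounded_funs X \<Longrightarrow> (\<lambda>x. f x + g x) \<in> bounded_funs X"
  unfolding bounded_funs_def by (force intro: order_trans[OF abs_triangle_ineq] add_mono)

lemma bounded_funs_const: "(\<lambda>x. c) \<in> bounded_funs X"
  by (auto simp: bounded_funs_def)

lemma bounded_funs_mult:
  assumes "f \<in> bounded_funs X" "g \<in> bounded_funs X"
  shows "(\<lambda>x. f x * g x) \<in> bounded_funs X"
proof -
  obtain C D where "\<forall>x\<in>X. \<bar>f x\<bar> \<le> C" "\<forall>x\<in>X. \<bar>g x\<bar> \<le> D"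
    using assms by (auto simp: bounded_funs_def)
  then have "\<bar>f x * g x\<bar> \<le> C * D" if "x \<in> X" for x
    using that mult_mono'[of "\<bar>f x\<bar>" C "\<bar>g x\<bar>" D] by (simp add: abs_mult)
  then show ?thesis by (rule bounded_funsI)
qed

lemma bounded_funs_scale: "f \<in> bounded_funs X \<Longrightarrow> (\<lambda>x. c * f x) \<in> bounded_funs X"
  by (rule bounded_funs_mult[OF bounded_funs_const])

lemma bounded_funs_sum:
  "(\<And>i. i \<in> I \<Longrightarrow> f i \<in> bounded_funs X) \<Longrightarrow> (\<lambda>x. \<Sum>i\<in>I. f i x) \<in> bounded_funs X"
  by (induction I rule: infinite_finite_induct)
    (auto intro: bounded_funs_add bounded_funs_const[of 0, simplified])

lemma bounded_funs_indicator: "indicat_real A \<in> bounded_funs X"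
  by (rule bounded_funsI[where C = 1]) (simp add: indicator_def)

locale mean_functional =
  fixes X :: "'a set" and m :: "('a \<Rightarrow> real) \<Rightarrow> real"
  assumes add: "f \<in> bounded_funs X \<Longrightarrow> g \<in> bounded_funs X \<Longrightarrow> m (\<lambda>x. f x + g x) = m f + m g"
    and scale: "f \<in> bounded_funs X \<Longrightarrow> m (\<lambda>x. c * f x) = c * m f"
    and nonneg: "f \<in> bounded_funs X \<Longrightarrow> (\<And>x. x \<in> X \<Longrightarrow> 0 \<le> f x) \<Longrightarrow> 0 \<le> m f"
    and one: "m (\<lambda>x. 1) = 1"

locale invariant_mean = group G + mean_functional "carrier G" m
  for G :: "('a, 'm) monoid_scheme" (structure) and m +
  assumes invariant: "k \<in> carrier G \<Longrightarrow> f \<in> bounded_funs (carrier G) \<Longrightarrow> m (\<lambda>x. f (k \<otimes> x)) = m f"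

lemma compact_functions_bounded_by: "compact {g :: 'b \<Rightarrow> real. \<forall>x. \<bar>g x\<bar> \<le> b x}"
proof -
  have "{g :: 'b \<Rightarrow> real. \<forall>x. \<bar>g x\<bar> \<le> b x} = PiE UNIV (\<lambda>x. {- b x..b x})"
    by (auto simp: PiE_def Pi_def abs_le_iff minus_le_iff)
  moreover have "compactin (product_topology (\<lambda>x. euclidean) UNIV) (PiE UNIV (\<lambda>x. {- b x..b x}))"
    by (simp add: compactin_PiE)
  ultimately show ?thesis by (simp add: euclidean_product_topology)
qed

lemma (in group) card_r_coset: "S \<subseteq> carrier G \<Longrightarrow> z \<in> carrier G \<Longrightarrow> card (S #> z) = card S"
proof -
  assume "S \<subseteq> carrier G" "z \<in> carrier G"
  moreover have "S #> z = (\<lambda>x. x \<otimes> z) ` S" by (auto simp: r_coset_def)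
  ultimately show ?thesis using card_image[OF inj_on_g[of S z]] by simp
qed

text \<open>
  The infimum and supremum in \<^const>\<open>sigma_R\<close> are resolved here once and for all: every finite set
  meets some right translate of \<open>A\<close> in at least the proportion \<open>c\<close>.
\<close>
lemma sigma_R_translate:
  fixes G :: "('a, 'm) monoid_scheme" (structure)
  assumes "group G" and c: "c < sigma_R G A" and F: "F \<subseteq> carrier G" "finite F" "F \<noteq> {}"
  obtains y where "y \<in> carrier G" "c * real (card F) \<le> real (card (F \<inter> (A #> y)))"
proof -
  interpret group G by fact
  let ?q = "\<lambda>F y. real (card (F \<inter> (A #> y))) / real (card F)"
  have q: "0 \<le> ?q F y" "?q F y \<le> 1" if "finite F" for F y
    using card_mono[OF that, of "F \<inter> (A #> y)"] by (auto simp: divide_le_eq_1)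
  have bdd: "bdd_above (?q F ` carrier G)" if "finite F" for F
    using q[OF that] by (intro bdd_aboveI[of _ 1]) auto
  have "sigma_R G A \<le> (SUP y\<in>carrier G. ?q F y)"
    unfolding sigma_R_def
  proof (rule cINF_lower)
    have "0 \<le> (SUP y\<in>carrier G. ?q F y)" if "finite F" for F
      using cSUP_upper[OF one_closed bdd[OF that]] q(1)[OF that, of \<one>] by linarith
    then show "bdd_below ((\<lambda>F. SUP y\<in>carrier G. ?q F y) ` {F. F \<subseteq> carrier G \<and> finite F \<and> F \<noteq> {}})"
      by (intro bdd_belowI[of _ 0]) auto
  qed (use F in simp)
  with c have "c < (SUP y\<in>carrier G. ?q F y)" by linarith
  then obtain y where y: "y \<in> carrier G" "c < ?q F y"
    using less_cSUP_iff[OF _ bdd[OF F(2)], of c] one_closed by blast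
  have "0 < real (card F)" using F by (simp add: card_gt_0_iff)
  then have "c * real (card F) \<le> real (card (F \<inter> (A #> y)))"
    using y(2) by (simp add: pos_less_divide_eq)
  with y(1) show thesis by (rule that)
qed

text \<open>
  The set \<open>F y\<^sup>-\<^sup>1\<close> has the same defect of left invariance as the Foelner set \<open>F\<close>, because left and
  right translations commute, and it meets \<open>A\<close> in a translate of \<open>F \<inter> A y\<close>.
\<close>
lemma amenable_folner_density:
  fixes G :: "('a, 'm) monoid_scheme" (structure)
  assumes am: "amenable_group G" and A: "A \<subseteq> carrier G" and c: "c < sigma_R G A"
    and K: "K \<subseteq> carrier G" "finite K" and "\<epsilon> > 0"
  obtains F where "F \<subseteq> carrier G" "finite F" "F \<noteq> {}" "c * real (card F) \<le> real (card (F \<inter> A))"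
    "\<And>k. k \<in> K \<Longrightarrow> real (card ((k <#\<^bsub>G\<^esub> F) - F)) \<le> \<epsilon> * real (card F)"
proof -
  interpret group G using am by (simp add: amenable_group_def)
  obtain F where F: "F \<subseteq> carrier G" "finite F" "F \<noteq> {}"
    "\<And>k. k \<in> K \<Longrightarrow> real (card ((k <#\<^bsub>G\<^esub> F) - F)) \<le> \<epsilon> * real (card F)"
    using amenable_folner[OF am K \<open>\<epsilon> > 0\<close>] by blast
  obtain y where y: "y \<in> carrier G" "c * real (card F) \<le> real (card (F \<inter> (A #> y)))"
    using sigma_R_translate[OF is_group c F(1-3)] by blast
  define z where "z = inv y"
  have z: "z \<in> carrier G" using y by (simp add: z_def)
  have mem: "x \<in> S #> z \<longleftrightarrow> x \<in> carrier G \<and> x \<otimes> y \<in> S" if "S \<subseteq> carrier G" for S x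
  proof
    assume "x \<in> S #> z"
    then obtain s where s: "s \<in> S" "x = s \<otimes> z" by (auto simp: r_coset_def)
    moreover have "s \<in> carrier G" using s(1) that by blast
    ultimately show "x \<in> carrier G \<and> x \<otimes> y \<in> S" using y(1) by (simp add: z_def m_assoc)
  next
    assume x: "x \<in> carrier G \<and> x \<otimes> y \<in> S"
    then have "x = (x \<otimes> y) \<otimes> z" using y(1) by (simp add: z_def m_assoc)
    with x show "x \<in> S #> z" by (auto simp: r_coset_def)
  qed
  have sub: "S #> z \<subseteq> carrier G" if "S \<subseteq> carrier G" for S using mem[OF that] by blast
  have memA: "x \<in> A #> y \<longleftrightarrow> x \<otimes> z \<in> A" if x: "x \<in> carrier G" for x
  proof
    assume "x \<in> A #> y"
    then obtain a where a: "a \<in> A" "x = a \<otimes> y" by (auto simp: r_coset_def)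
    moreover have "a \<in> carrier G" using a(1) A by blast
    ultimately show "x \<otimes> z \<in> A" using y(1) by (simp add: z_def m_assoc)
  next
    assume xz: "x \<otimes> z \<in> A"
    have "x = (x \<otimes> z) \<otimes> y" using y(1) x by (simp add: z_def m_assoc)
    with xz show "x \<in> A #> y" by (auto simp: r_coset_def)
  qed
  have int: "(F #> z) \<inter> A = (F \<inter> (A #> y)) #> z"
  proof (rule Set.set_eqI)
    fix x
    have "x \<in> (F \<inter> (A #> y)) #> z \<longleftrightarrow> x \<in> carrier G \<and> x \<otimes> y \<in> F \<and> x \<otimes> y \<in> A #> y"
      using mem[of "F \<inter> (A #> y)" x] F(1) by auto
    also have "\<dots> \<longleftrightarrow> x \<in> carrier G \<and> x \<otimes> y \<in> F \<and> x \<in> A"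
      using memA y(1) by (auto simp: z_def m_assoc)
    also have "\<dots> \<longleftrightarrow> x \<in> (F #> z) \<inter> A" using mem[OF F(1)] by auto
    finally show "x \<in> (F #> z) \<inter> A \<longleftrightarrow> x \<in> (F \<inter> (A #> y)) #> z" by simp
  qed
  show thesis
  proof (rule that[of "F #> z"])
    show "F #> z \<subseteq> carrier G" using sub[OF F(1)] .
    show "finite (F #> z)" using F(2) by (auto simp: r_coset_def)
    show "F #> z \<noteq> {}" using F(3) by (auto simp: r_coset_def)
    show "c * real (card (F #> z)) \<le> real (card ((F #> z) \<inter> A))"
    proof -
      have "F \<inter> (A #> y) \<subseteq> carrier G" using F(1) by blast
      then show ?thesis using y(2) by (simp add: int card_r_coset F(1) z)
    qed
    fix k assume k: "k \<in> K"
    then have kG: "k \<in> carrier G" using K(1) by blast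
    have "(k <#\<^bsub>G\<^esub> (F #> z)) - (F #> z) = ((k <#\<^bsub>G\<^esub> F) - F) #> z"
    proof -
      have kF: "k <#\<^bsub>G\<^esub> F \<subseteq> carrier G" by (rule l_coset_subset_G[OF F(1) kG])
      have "k <#\<^bsub>G\<^esub> (F #> z) = (k <#\<^bsub>G\<^esub> F) #> z"
        using coset_assoc[OF kG z F(1)] by simp
      moreover have "(k <#\<^bsub>G\<^esub> F) - F \<subseteq> carrier G" using kF by blast
      ultimately show ?thesis using mem[OF kF] mem[OF F(1)] mem[of "(k <#\<^bsub>G\<^esub> F) - F"] by auto
    qed
    moreover have "(k <#\<^bsub>G\<^esub> F) - F \<subseteq> carrier G" using l_coset_subset_G[OF F(1) kG] by blast
    ultimately show "real (card ((k <#\<^bsub>G\<^esub> (F #> z)) - (F #> z))) \<le> \<epsilon> * real (card (F #> z))"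
      using F(4)[OF k] by (simp add: card_r_coset F(1) z)
  qed
qed

text \<open>
  The averages over finite sets lie in a product of compact intervals, one for each function. The
  closures of the sets of averages over \<open>(K, \<epsilon>)\<close>-invariant sets that are dense in \<open>A\<close> have
  the finite intersection property, so they share a point \<open>\<Lambda>\<close>. Linearity, positivity, the bound on
  \<open>A\<close> and approximate invariance are closed conditions on functionals, so they pass to \<open>\<Lambda>\<close>.
\<close>
theorem invariant_mean_positive:
  fixes G :: "('a, 'm) monoid_scheme" (structure)
  assumes am: "amenable_group G" and A: "A \<subseteq> carrier G" and pos: "0 < sigma_R G A"
  obtains m where "invariant_mean G m" "0 < m (indicat_real A)"
proof -
  interpret group G using am by (simp add: amenable_group_def)
  define c where "c = sigma_R G A / 2"
  have c: "0 < c" "c < sigma_R G A" using pos by (simp_all add: c_def)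
  let ?B = "bounded_funs (carrier G)"
  define b where "b f = (if f \<in> ?B then SUP x\<in>carrier G. \<bar>f x\<bar> else 0)" for f :: "'a \<Rightarrow> real"
  \<comment> \<open>The value 0 at unbounded functions keeps every average inside one compact box.\<close>
  define avg where "avg F f = (if f \<in> ?B then (\<Sum>x\<in>F. f x) / real (card F) else 0)"
    for F and f :: "'a \<Rightarrow> real"
  define fol where "fol K \<epsilon> F \<longleftrightarrow> F \<subseteq> carrier G \<and> finite F \<and> F \<noteq> {} \<and>
      c * real (card F) \<le> real (card (F \<inter> A)) \<and>
      (\<forall>k\<in>K. real (card ((k <#\<^bsub>G\<^esub> F) - F)) \<le> \<epsilon> * real (card F))" for K \<epsilon> F
  have fol_ex: "\<exists>F. fol K \<epsilon> F" if "K \<subseteq> carrier G" "finite K" "\<epsilon> > 0" for K \<epsilon>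
    unfolding fol_def using amenable_folner_density[OF am A c(2) that] by metis
  have fol_mono: "fol K \<epsilon> F" if "fol K' \<epsilon>' F" "K \<subseteq> K'" "\<epsilon>' \<le> \<epsilon>" for K K' \<epsilon> \<epsilon>' F
  proof -
    have "\<epsilon>' * real (card F) \<le> \<epsilon> * real (card F)" using that(3) by (rule mult_right_mono) simp
    then show ?thesis using that(1,2) unfolding fol_def by (meson order_trans subsetD)
  qed
  have b: "\<bar>f x\<bar> \<le> b f" if "f \<in> ?B" "x \<in> carrier G" for f x
  proof -
    have "bdd_above ((\<lambda>x. \<bar>f x\<bar>) ` carrier G)" using that(1) by (auto simp: bounded_funs_def bdd_above_def)
    then show ?thesis using cSUP_upper[OF that(2)] that(1) by (simp add: b_def)
  qed
  have avg_b: "\<bar>avg F f\<bar> \<le> b f" if F: "fol K \<epsilon> F" for K \<epsilon> F f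
  proof (cases "f \<in> ?B")
    case True
    have "0 < real (card F)" using F by (simp add: fol_def card_gt_0_iff)
    moreover have "\<bar>\<Sum>x\<in>F. f x\<bar> \<le> (\<Sum>x\<in>F. b f)"
      using F b[OF True] by (intro order_trans[OF sum_abs] sum_mono) (auto simp: fol_def)
    ultimately show ?thesis using True by (simp add: avg_def divide_le_eq mult.commute)
  qed (simp add: avg_def b_def)
  define Box where "Box = {\<Lambda> :: ('a \<Rightarrow> real) \<Rightarrow> real. \<forall>f. \<bar>\<Lambda> f\<bar> \<le> b f}"
  define P where "P p = avg ` {F. fol (fst p) (snd p) F}" for p
  define Q where "Q = {(K, \<epsilon>). K \<subseteq> carrier G \<and> finite K \<and> (0::real) < \<epsilon>}"
  have "Box \<inter> \<Inter> ((\<lambda>p. closure (P p)) ` Q) \<noteq> {}"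
  proof (rule compact_imp_fip)
    show "compact Box" unfolding Box_def by (rule compact_functions_bounded_by)
    show "closed T" if "T \<in> (\<lambda>p. closure (P p)) ` Q" for T using that by auto
    fix \<F> assume "finite \<F>" "\<F> \<subseteq> (\<lambda>p. closure (P p)) ` Q"
    then obtain I where I: "I \<subseteq> Q" "finite I" "\<F> = (\<lambda>p. closure (P p)) ` I"
      using finite_subset_image by metis
    define K where "K = \<Union> (fst ` I)"
    define \<epsilon> where "\<epsilon> = Min (insert 1 (snd ` I))"
    have IQ: "fst p \<subseteq> carrier G" "finite (fst p)" "0 < snd p" if "p \<in> I" for p
      using subsetD[OF I(1) that] by (auto simp: Q_def)
    have "K \<subseteq> carrier G" unfolding K_def using IQ(1) by blast
    moreover have "finite K" unfolding K_def using IQ(2) I(2) by blast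
    moreover have "\<epsilon> > 0" unfolding \<epsilon>_def using IQ(3) I(2) by simp
    ultimately obtain F where F: "fol K \<epsilon> F" using fol_ex by blast
    have "avg F \<in> closure (P p)" if "p \<in> I" for p
    proof -
      have "fol (fst p) (snd p) F"
        using that I(2) by (intro fol_mono[OF F]) (auto simp: K_def \<epsilon>_def)
      then show ?thesis using closure_subset[of "P p"] by (auto simp: P_def)
    qed
    moreover have "avg F \<in> Box" using avg_b[OF F] by (simp add: Box_def)
    ultimately show "Box \<inter> \<Inter>\<F> \<noteq> {}" using I(3) by blast
  qed
  then obtain \<Lambda> where \<Lambda>: "\<And>p. p \<in> Q \<Longrightarrow> \<Lambda> \<in> closure (P p)" by blast
  have limit: "\<Lambda> \<in> S" if "closed S" "K \<subseteq> carrier G" "finite K" "\<epsilon> > 0"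
    "\<And>F. fol K \<epsilon> F \<Longrightarrow> avg F \<in> S" for S K \<epsilon>
  proof -
    have "closure (P (K, \<epsilon>)) \<subseteq> S" using that(1,5) by (intro closure_minimal) (auto simp: P_def)
    then show ?thesis using \<Lambda>[of "(K, \<epsilon>)"] that(2-4) by (auto simp: Q_def)
  qed
  have limit0: "\<Lambda> \<in> S" if "closed S" "\<And>F. fol {} 1 F \<Longrightarrow> avg F \<in> S" for S
    using limit[of S "{}" 1] that by simp
  have ev: "continuous_on UNIV (\<lambda>\<Lambda> :: ('a \<Rightarrow> real) \<Rightarrow> real. \<Lambda> f)" for f by simp
  have "invariant_mean G \<Lambda>"
  proof unfold_locales
    fix f g assume fg: "f \<in> ?B" "g \<in> ?B"
    have "\<Lambda> \<in> {\<Lambda>. \<Lambda> (\<lambda>x. f x + g x) = \<Lambda> f + \<Lambda> g}"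
    proof (rule limit0)
      show "closed {\<Lambda> :: ('a \<Rightarrow> real) \<Rightarrow> real. \<Lambda> (\<lambda>x. f x + g x) = \<Lambda> f + \<Lambda> g}"
        by (intro closed_Collect_eq continuous_on_add ev)
    qed (use fg bounded_funs_add[OF fg] in \<open>simp add: avg_def sum.distrib add_divide_distrib\<close>)
    then show "\<Lambda> (\<lambda>x. f x + g x) = \<Lambda> f + \<Lambda> g" by simp
  next
    fix f :: "'a \<Rightarrow> real" and r :: real assume f: "f \<in> ?B"
    have "\<Lambda> \<in> {\<Lambda>. \<Lambda> (\<lambda>x. r * f x) = r * \<Lambda> f}"
    proof (rule limit0)
      show "closed {\<Lambda> :: ('a \<Rightarrow> real) \<Rightarrow> real. \<Lambda> (\<lambda>x. r * f x) = r * \<Lambda> f}"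
        by (intro closed_Collect_eq continuous_on_mult_left ev)
    qed (use f bounded_funs_scale[OF f] in \<open>simp add: avg_def sum_distrib_left\<close>)
    then show "\<Lambda> (\<lambda>x. r * f x) = r * \<Lambda> f" by simp
  next
    fix f :: "'a \<Rightarrow> real" assume f: "f \<in> ?B" "\<And>x. x \<in> carrier G \<Longrightarrow> 0 \<le> f x"
    have "\<Lambda> \<in> {\<Lambda>. 0 \<le> \<Lambda> f}"
    proof (rule limit0)
      show "closed {\<Lambda> :: ('a \<Rightarrow> real) \<Rightarrow> real. 0 \<le> \<Lambda> f}"
        by (intro closed_Collect_le continuous_on_const ev)
      show "avg F \<in> {\<Lambda>. 0 \<le> \<Lambda> f}" if "fol {} 1 F" for F
        using that f(2) by (auto simp: avg_def fol_def intro!: divide_nonneg_nonneg sum_nonneg)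
    qed
    then show "0 \<le> \<Lambda> f" by simp
  next
    have "\<Lambda> \<in> {\<Lambda>. \<Lambda> (\<lambda>x. 1) = 1}"
    proof (rule limit0)
      show "closed {\<Lambda> :: ('a \<Rightarrow> real) \<Rightarrow> real. \<Lambda> (\<lambda>x. 1) = 1}"
        by (intro closed_Collect_eq continuous_on_const ev)
    qed (use bounded_funs_const[of 1 "carrier G"] in \<open>simp add: avg_def fol_def\<close>)
    then show "\<Lambda> (\<lambda>x. 1) = 1" by simp
  next
    fix k f assume k: "k \<in> carrier G" and f: "f \<in> ?B"
    let ?fk = "\<lambda>x. f (k \<otimes> x)"
    have fk: "?fk \<in> ?B" using b[OF f] k by (intro bounded_funsI[where C = "b f"]) simp
    have b0: "0 \<le> b f" using b[OF f one_closed] by linarith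
    have "\<bar>\<Lambda> ?fk - \<Lambda> f\<bar> \<le> e" if "e > 0" for e
    proof -
      \<comment> \<open>Moving \<open>F\<close> by \<open>k\<close> changes the average of \<open>f\<close> by at most \<open>2 * b f * \<epsilon>\<close>; adding 1 covers \<open>b f = 0\<close>.\<close>
      define \<epsilon> where "\<epsilon> = e / (2 * b f + 1)"
      have \<epsilon>: "\<epsilon> > 0" "2 * b f * \<epsilon> \<le> e" using that b0 by (simp_all add: \<epsilon>_def field_simps)
      have "\<Lambda> \<in> {\<Lambda>. \<bar>\<Lambda> ?fk - \<Lambda> f\<bar> \<le> e}"
      proof (rule limit[where K = "{k}" and \<epsilon> = \<epsilon>])
        show "closed {\<Lambda> :: ('a \<Rightarrow> real) \<Rightarrow> real. \<bar>\<Lambda> ?fk - \<Lambda> f\<bar> \<le> e}"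
          by (intro closed_Collect_le continuous_on_const continuous_on_rabs continuous_on_diff ev)
        fix F assume F: "fol {k} \<epsilon> F"
        then have FG: "F \<subseteq> carrier G" "finite F" "0 < real (card F)"
          and Fk: "real (card ((k <#\<^bsub>G\<^esub> F) - F)) \<le> \<epsilon> * real (card F)"
          by (simp_all add: fol_def card_gt_0_iff)
        let ?kF = "k <#\<^bsub>G\<^esub> F"
        have kF: "?kF = (\<lambda>x. k \<otimes> x) ` F" by (auto simp: l_coset_def)
        have inj: "inj_on (\<lambda>x. k \<otimes> x) F" using k FG(1) by (auto simp: inj_on_def subset_iff)
        have fin: "finite ?kF" using FG(2) kF by simp
        have card_kF: "card ?kF = card F" using card_image[OF inj] kF by simp
        have kFG: "?kF \<subseteq> carrier G" by (rule l_coset_subset_G[OF FG(1) k])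
        have swap: "card (F - ?kF) = card (?kF - F)"
          using card_Int_Diff[OF FG(2), of ?kF] card_Int_Diff[OF fin, of F] card_kF
          by (simp add: Int_commute)
        have part: "\<bar>\<Sum>x\<in>D. f x\<bar> \<le> real (card D) * b f" if "D \<subseteq> carrier G" for D
        proof -
          have "\<bar>\<Sum>x\<in>D. f x\<bar> \<le> (\<Sum>x\<in>D. \<bar>f x\<bar>)" by (rule sum_abs)
          also have "\<dots> \<le> (\<Sum>x\<in>D. b f)" using that by (intro sum_mono b[OF f]) blast
          finally show ?thesis by simp
        qed
        \<comment> \<open>The two averages differ only on the symmetric difference of \<open>F\<close> and \<open>k F\<close>.\<close>
        have "(\<Sum>x\<in>F. ?fk x) = (\<Sum>x\<in>?kF. f x)"
          unfolding kF sum.reindex[OF inj] by simp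
        then have "(\<Sum>x\<in>F. ?fk x) - (\<Sum>x\<in>F. f x) = (\<Sum>x\<in>?kF - F. f x) - (\<Sum>x\<in>F - ?kF. f x)"
          using sum.Int_Diff[OF FG(2), of f ?kF] sum.Int_Diff[OF fin, of f F]
          by (simp add: Int_commute)
        moreover have "\<bar>\<Sum>x\<in>?kF - F. f x\<bar> \<le> real (card (?kF - F)) * b f"
          using kFG by (intro part) auto
        moreover have "\<bar>\<Sum>x\<in>F - ?kF. f x\<bar> \<le> real (card (?kF - F)) * b f"
          unfolding swap[symmetric] using FG(1) by (intro part) auto
        ultimately have "\<bar>(\<Sum>x\<in>F. ?fk x) - (\<Sum>x\<in>F. f x)\<bar> \<le> 2 * (real (card (?kF - F)) * b f)"
          by linarith
        also have "\<dots> \<le> 2 * ((\<epsilon> * real (card F)) * b f)"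
          using mult_right_mono[OF Fk b0] by simp
        also have "\<dots> = (2 * b f * \<epsilon>) * real (card F)" by simp
        also have "\<dots> \<le> e * real (card F)"
          using \<epsilon>(2) by (rule mult_right_mono) simp
        finally have "\<bar>((\<Sum>x\<in>F. ?fk x) - (\<Sum>x\<in>F. f x)) / real (card F)\<bar> \<le> e"
          using FG(3) by (simp add: divide_le_eq)
        then show "avg F \<in> {\<Lambda>. \<bar>\<Lambda> ?fk - \<Lambda> f\<bar> \<le> e}"
          using f fk by (simp add: avg_def diff_divide_distrib)
      qed (use k \<epsilon> in simp_all)
      then show ?thesis by simp
    qed
    then have "\<bar>\<Lambda> ?fk - \<Lambda> f\<bar> \<le> 0" by (rule field_le_epsilon) simp
    then show "\<Lambda> ?fk = \<Lambda> f" by simp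
  qed
  moreover have "\<Lambda> \<in> {\<Lambda>. c \<le> \<Lambda> (indicat_real A)}"
  proof (rule limit0)
    show "closed {\<Lambda> :: ('a \<Rightarrow> real) \<Rightarrow> real. c \<le> \<Lambda> (indicat_real A)}"
      by (intro closed_Collect_le continuous_on_const ev)
    show "avg F \<in> {\<Lambda>. c \<le> \<Lambda> (indicat_real A)}" if "fol {} 1 F" for F
    proof -
      have F: "finite F" "0 < real (card F)" "c * real (card F) \<le> real (card (F \<inter> A))"
        using that by (simp_all add: fol_def card_gt_0_iff)
      have "(\<Sum>x\<in>F. indicat_real A x) = real (card (F \<inter> A))"
        using F(1) by (simp add: indicator_def Int_def)
      then show ?thesis
        using F bounded_funs_indicator[of A "carrier G"] by (simp add: avg_def pos_le_divide_eq)
    qed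
  qed
  ultimately show thesis using that[of \<Lambda>] c(1) by simp
qed

section \<open>The semi-inner product of a mean\<close>

context mean_functional
begin

lemma diff:
  assumes "f \<in> bounded_funs X" "g \<in> bounded_funs X"
  shows "m (\<lambda>x. f x - g x) = m f - m g"
  using add[OF assms(1) bounded_funs_scale[OF assms(2), of "-1"]] scale[OF assms(2), of "-1"] by simp

lemma sum:
  assumes "finite I" "\<And>i. i \<in> I \<Longrightarrow> f i \<in> bounded_funs X"
  shows "m (\<lambda>x. \<Sum>i\<in>I. f i x) = (\<Sum>i\<in>I. m (f i))"
  using assms
proof (induction I rule: finite_induct)
  case empty
  show ?case using scale[OF bounded_funs_const[of 0], of 0] by simp
next
  case (insert i I)
  then show ?case using add[of "f i" "\<lambda>x. \<Sum>i\<in>I. f i x"] by (simp add: bounded_funs_sum)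
qed

lemma mono:
  assumes "f \<in> bounded_funs X" "g \<in> bounded_funs X" "\<And>x. x \<in> X \<Longrightarrow> f x \<le> g x"
  shows "m f \<le> m g"
proof -
  have "0 \<le> m (\<lambda>x. g x + (-1) * f x)"
    using assms by (intro nonneg bounded_funs_add bounded_funs_scale) auto
  also have "\<dots> = m g - m f" using diff[OF assms(2,1)] by simp
  finally show ?thesis by simp
qed

lemma const: "m (\<lambda>x. c) = c"
  using scale[OF bounded_funs_const[of 1], of c] one by simp

lemma abs_le:
  assumes "\<And>x. x \<in> X \<Longrightarrow> \<bar>f x\<bar> \<le> C"
  shows "\<bar>m f\<bar> \<le> C"
proof -
  have f: "f \<in> bounded_funs X" using assms by (rule bounded_funsI)
  have "m f \<le> m (\<lambda>x. C)" "m (\<lambda>x. - C) \<le> m f"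
    using assms by (intro mono f bounded_funs_const; force simp: abs_le_iff)+
  then show ?thesis by (simp add: const abs_le_iff)
qed

lemma cong:
  assumes f: "f \<in> bounded_funs X" and eq: "\<And>x. x \<in> X \<Longrightarrow> f x = g x"
  shows "m f = m g"
proof -
  have g: "g \<in> bounded_funs X" using f eq by (auto simp: bounded_funs_def)
  show ?thesis using mono[OF f g] mono[OF g f] eq by (simp add: order_antisym)
qed

text \<open>
  A mean behaves like an integral: it turns the bounded functions into a vector space with a
  positive semidefinite inner product, in which the geometry of a Hilbert space is available as
  far as finite families of vectors are concerned.
\<close>
definition ip :: "('a \<Rightarrow> real) \<Rightarrow> ('a \<Rightarrow> real) \<Rightarrow> real" where
  "ip u v = m (\<lambda>x. u x * v x)"

lemma ip_commute: "ip u v = ip v u"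
  by (simp add: ip_def mult.commute)

lemma ip_diff:
  "u \<in> bounded_funs X \<Longrightarrow> v \<in> bounded_funs X \<Longrightarrow> w \<in> bounded_funs X \<Longrightarrow>
    ip (\<lambda>x. u x - v x) w = ip u w - ip v w"
  unfolding ip_def by (simp add: left_diff_distrib diff bounded_funs_mult)

lemma ip_scale:
  "u \<in> bounded_funs X \<Longrightarrow> w \<in> bounded_funs X \<Longrightarrow> ip (\<lambda>x. c * u x) w = c * ip u w"
  unfolding ip_def by (simp add: mult.assoc scale bounded_funs_mult)

lemma ip_sum:
  assumes "finite I" "\<And>i. i \<in> I \<Longrightarrow> u i \<in> bounded_funs X" "w \<in> bounded_funs X"
  shows "ip (\<lambda>x. \<Sum>i\<in>I. u i x) w = (\<Sum>i\<in>I. ip (u i) w)"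
  unfolding ip_def sum_distrib_right using assms by (intro sum bounded_funs_mult) auto

lemma ip_nonneg: "u \<in> bounded_funs X \<Longrightarrow> 0 \<le> ip u u"
  unfolding ip_def by (intro nonneg bounded_funs_mult) auto

text \<open>The case of a vector \<open>v\<close> with \<open>ip v v = 0\<close> does occur, as the inner product is only semidefinite.\<close>
lemma cauchy_schwarz:
  assumes u: "u \<in> bounded_funs X" and v: "v \<in> bounded_funs X"
  shows "(ip u v)\<^sup>2 \<le> ip u u * ip v v"
proof -
  have quad: "0 \<le> ip u u - 2 * t * ip u v + t\<^sup>2 * ip v v" for t
  proof -
    let ?w = "\<lambda>x. u x - t * v x"
    have tv: "(\<lambda>x. t * v x) \<in> bounded_funs X" using v by (rule bounded_funs_scale)
    have w: "?w \<in> bounded_funs X"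
      using bounded_funs_add[OF u bounded_funs_scale[OF v, of "- t"]] by simp
    have wu: "ip ?w u = ip u u - t * ip u v"
      by (simp add: ip_diff[OF u tv u] ip_scale[OF v u] ip_commute[of v u])
    have wv: "ip ?w v = ip u v - t * ip v v" by (simp add: ip_diff[OF u tv v] ip_scale[OF v v])
    have "ip ?w ?w = ip u ?w - t * ip v ?w" by (simp add: ip_diff[OF u tv w] ip_scale[OF v w])
    also have "\<dots> = ip ?w u - t * ip ?w v" by (simp only: ip_commute)
    also have "\<dots> = ip u u - 2 * t * ip u v + t\<^sup>2 * ip v v"
      unfolding wu wv by (simp add: algebra_simps power2_eq_square)
    finally show ?thesis using ip_nonneg[OF w] by simp
  qed
  show ?thesis
  proof (cases "ip v v = 0")
    case True
    have "ip u v = 0"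
    proof (rule ccontr)
      assume "ip u v \<noteq> 0"
      then have "2 * ((ip u u + 1) / (2 * ip u v)) * ip u v = ip u u + 1" by simp
      with quad[of "(ip u u + 1) / (2 * ip u v)"] True show False by simp
    qed
    then show ?thesis using True by simp
  next
    case False
    then have pos: "0 < ip v v" using ip_nonneg[OF v] by simp
    define t where "t = ip u v / ip v v"
    have "ip u u - 2 * t * ip u v + t\<^sup>2 * ip v v = ip u u - (ip u v)\<^sup>2 / ip v v"
      using False by (simp add: t_def field_simps power2_eq_square)
    then have "(ip u v)\<^sup>2 / ip v v \<le> ip u u" using quad[of t] by simp
    then show ?thesis using pos by (simp add: divide_le_eq)
  qed
qed

definition orthonormal :: "('a \<Rightarrow> real) set \<Rightarrow> bool" where
  "orthonormal E \<longleftrightarrow> finite E \<and> E \<subseteq> bounded_funs X \<and>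
     (\<forall>e\<in>E. \<forall>e'\<in>E. ip e e' = (if e = e' then 1 else 0))"

text \<open>The difference between \<open>u\<close> and its orthogonal projection to the span of \<open>E\<close>.\<close>
definition residual :: "('a \<Rightarrow> real) set \<Rightarrow> ('a \<Rightarrow> real) \<Rightarrow> 'a \<Rightarrow> real" where
  "residual E u = (\<lambda>x. u x - (\<Sum>e\<in>E. ip u e * e x))"

lemma
  assumes E: "orthonormal E" and u: "u \<in> bounded_funs X"
  shows residual_bounded: "residual E u \<in> bounded_funs X"
    and ip_residual: "w \<in> bounded_funs X \<Longrightarrow> ip (residual E u) w = ip u w - (\<Sum>e\<in>E. ip u e * ip e w)"
    and residual_orthogonal: "e \<in> E \<Longrightarrow> ip (residual E u) e = 0"
    and ip_residual_self: "ip (residual E u) (residual E u) = ip u u - (\<Sum>e\<in>E. (ip u e)\<^sup>2)"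
proof -
  have fin: "finite E" and EB: "\<And>e. e \<in> E \<Longrightarrow> e \<in> bounded_funs X"
    and on: "\<And>e e'. e \<in> E \<Longrightarrow> e' \<in> E \<Longrightarrow> ip e e' = (if e = e' then 1 else 0)"
    using E by (auto simp: orthonormal_def)
  have s: "(\<lambda>x. \<Sum>e\<in>E. ip u e * e x) \<in> bounded_funs X"
    using EB by (intro bounded_funs_sum bounded_funs_scale)
  show r: "residual E u \<in> bounded_funs X"
    using bounded_funs_add[OF u bounded_funs_scale[OF s, of "-1"]] by (simp add: residual_def)
  show ipr: "ip (residual E u) w = ip u w - (\<Sum>e\<in>E. ip u e * ip e w)" if w: "w \<in> bounded_funs X" for w
  proof -
    have "ip (\<lambda>x. \<Sum>e\<in>E. ip u e * e x) w = (\<Sum>e\<in>E. ip (\<lambda>x. ip u e * e x) w)"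
      using EB w by (intro ip_sum fin bounded_funs_scale)
    also have "\<dots> = (\<Sum>e\<in>E. ip u e * ip e w)"
      using EB w by (intro sum.cong refl ip_scale)
    finally show ?thesis unfolding residual_def ip_diff[OF u s w] by simp
  qed
  show orth: "ip (residual E u) e = 0" if e: "e \<in> E" for e
  proof -
    have "(\<Sum>e'\<in>E. ip u e' * ip e' e) = (\<Sum>e'\<in>E. if e' = e then ip u e' else 0)"
      using e by (intro sum.cong refl) (simp add: on)
    then show ?thesis using ipr[OF EB[OF e]] e fin by simp
  qed
  have "ip (residual E u) (residual E u) = ip u (residual E u) - (\<Sum>e\<in>E. ip u e * ip e (residual E u))"
    by (rule ipr[OF r])
  also have "(\<Sum>e\<in>E. ip u e * ip e (residual E u)) = 0"
    using orth by (intro sum.neutral) (simp add: ip_commute)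
  also have "ip u (residual E u) = ip u u - (\<Sum>e\<in>E. (ip u e)\<^sup>2)"
  proof -
    have "ip e u = ip u e" for e by (rule ip_commute)
    then have "(\<Sum>e\<in>E. ip u e * ip e u) = (\<Sum>e\<in>E. (ip u e)\<^sup>2)" by (simp only: power2_eq_square)
    then show ?thesis using ipr[OF u] ip_commute[of u "residual E u"] by simp
  qed
  finally show "ip (residual E u) (residual E u) = ip u u - (\<Sum>e\<in>E. (ip u e)\<^sup>2)" by simp
qed

lemma bessel:
  assumes "orthonormal E" "u \<in> bounded_funs X"
  shows "(\<Sum>e\<in>E. (ip u e)\<^sup>2) \<le> ip u u"
  using ip_residual_self[OF assms] ip_nonneg[OF residual_bounded[OF assms]] by linarith

end

section \<open>Kernels of finite rank up to a small error\<close>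

text \<open>
  Choose an orthonormal set \<open>E\<close> of maximal size among those whose members \<open>e\<close> all satisfy
  \<open>\<mu> (\<lambda>a. \<langle>\<xi> a, e\<rangle>\<^sup>2) \<ge> \<delta>\<close>; Bessel's inequality bounds the size by \<open>1 / \<delta>\<close>. Then for every \<open>b\<close> the
  residual \<open>r\<close> of \<open>\<xi> b\<close> must satisfy \<open>\<mu> (\<lambda>a. \<langle>\<xi> a, r\<rangle>\<^sup>2) \<le> \<delta>\<close>, as otherwise the normalised residual
  could be added to \<open>E\<close>. So in the inner product \<open>\<langle>\<xi> a, \<xi> b\<rangle>\<close> the vector \<open>\<xi> b\<close> may be replaced by
  its projection to the span of \<open>E\<close>, at a cost that is controlled by the Cauchy-Schwarz
  inequality for \<open>\<mu>\<close>. The bound is uniform in \<open>f\<close> and \<open>b\<close>.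
\<close>
lemma mean_kernel_finite_rank:
  fixes \<xi> :: "'a \<Rightarrow> 'b \<Rightarrow> real"
  assumes \<mu>: "mean_functional X \<mu>" and \<nu>: "mean_functional Y \<nu>"
    and \<xi>: "\<And>a y. a \<in> X \<Longrightarrow> y \<in> Y \<Longrightarrow> \<bar>\<xi> a y\<bar> \<le> 1" and "\<epsilon> > 0"
  shows "\<exists>(E :: ('b \<Rightarrow> real) set) u. finite E \<and> (\<forall>e\<in>E. \<forall>a\<in>X. \<bar>u e a\<bar> \<le> 1) \<and>
    (\<forall>f. (\<forall>a\<in>X. \<bar>f a\<bar> \<le> 1) \<longrightarrow> (\<forall>b\<in>X.
      \<bar>\<mu> (\<lambda>a. f a * \<nu> (\<lambda>y. \<xi> a y * \<xi> b y)) - (\<Sum>e\<in>E. u e b * \<mu> (\<lambda>a. f a * u e a))\<bar> \<le> \<epsilon>))"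
proof -
  interpret M: mean_functional X \<mu> by fact
  interpret N: mean_functional Y \<nu> by fact
  \<comment> \<open>The Cauchy-Schwarz inequality turns a bound \<open>\<delta>\<close> on the square into the error \<open>\<epsilon>\<close>.\<close>
  define \<delta> where "\<delta> = \<epsilon>\<^sup>2"
  have \<delta>: "\<delta> > 0" using \<open>\<epsilon> > 0\<close> by (simp add: \<delta>_def)
  have \<xi>B: "\<xi> a \<in> bounded_funs Y" if "a \<in> X" for a using \<xi>[OF that] by (rule bounded_funsI)
  have ip_\<xi>: "N.ip (\<xi> a) (\<xi> a) \<le> 1" if a: "a \<in> X" for a
  proof -
    have "\<bar>\<xi> a y * \<xi> a y\<bar> \<le> 1" if "y \<in> Y" for y
      unfolding abs_mult by (rule mult_le_one[OF \<xi>[OF a that] abs_ge_zero \<xi>[OF a that]])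
    then have "\<bar>N.ip (\<xi> a) (\<xi> a)\<bar> \<le> 1" unfolding N.ip_def by (rule N.abs_le)
    then show ?thesis by simp
  qed
  have ip_bounded: "(\<lambda>a. N.ip (\<xi> a) w) \<in> bounded_funs X" if w: "w \<in> bounded_funs Y" for w
  proof -
    obtain C where C: "\<And>y. y \<in> Y \<Longrightarrow> \<bar>w y\<bar> \<le> C" using w by (auto simp: bounded_funs_def)
    show ?thesis
    proof (rule bounded_funsI)
      fix a assume a: "a \<in> X"
      have "\<bar>\<xi> a y * w y\<bar> \<le> C" if "y \<in> Y" for y
        using mult_mono[OF \<xi>[OF a that] C[OF that]] by (simp add: abs_mult)
      then show "\<bar>N.ip (\<xi> a) w\<bar> \<le> C" unfolding N.ip_def by (rule N.abs_le)
    qed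
  qed
  have sq_bounded: "(\<lambda>a. (N.ip (\<xi> a) w)\<^sup>2) \<in> bounded_funs X" if w: "w \<in> bounded_funs Y" for w
    unfolding power2_eq_square by (intro bounded_funs_mult ip_bounded w)
  define big where "big E \<longleftrightarrow> N.orthonormal E \<and> (\<forall>e\<in>E. \<delta> \<le> \<mu> (\<lambda>a. (N.ip (\<xi> a) e)\<^sup>2))" for E
  have big_card: "card E \<le> nat \<lceil>1 / \<delta>\<rceil>" if E: "big E" for E
  proof -
    have on: "N.orthonormal E" and fin: "finite E" and EB: "\<And>e. e \<in> E \<Longrightarrow> e \<in> bounded_funs Y"
      using E by (auto simp: big_def N.orthonormal_def)
    have "real (card E) * \<delta> = (\<Sum>e\<in>E. \<delta>)" by simp
    also have "\<dots> \<le> (\<Sum>e\<in>E. \<mu> (\<lambda>a. (N.ip (\<xi> a) e)\<^sup>2))"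
      using E by (intro sum_mono) (simp add: big_def)
    also have "\<dots> = \<mu> (\<lambda>a. \<Sum>e\<in>E. (N.ip (\<xi> a) e)\<^sup>2)"
      by (rule M.sum[symmetric]) (use fin sq_bounded EB in auto)
    also have "\<dots> \<le> \<mu> (\<lambda>a. 1)"
    proof (rule M.mono)
      show "(\<lambda>a. \<Sum>e\<in>E. (N.ip (\<xi> a) e)\<^sup>2) \<in> bounded_funs X"
        by (intro bounded_funs_sum sq_bounded EB)
      show "(\<Sum>e\<in>E. (N.ip (\<xi> a) e)\<^sup>2) \<le> 1" if "a \<in> X" for a
        using N.bessel[OF on \<xi>B[OF that]] ip_\<xi>[OF that] by linarith
    qed (rule bounded_funs_const)
    finally have "real (card E) \<le> 1 / \<delta>" using \<delta> by (simp add: M.one pos_le_divide_eq)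
    then show ?thesis by linarith
  qed
  have "big {}" by (simp add: big_def N.orthonormal_def)
  then obtain E where E: "big E" and max: "\<And>E'. big E' \<Longrightarrow> card E' \<le> card E"
    using ex_has_greatest_nat[of big "{}" card "Suc (nat \<lceil>1 / \<delta>\<rceil>)"] big_card
    by (metis le_imp_less_Suc)
  have on: "N.orthonormal E" and fin: "finite E" and EB: "\<And>e. e \<in> E \<Longrightarrow> e \<in> bounded_funs Y"
    and ipE: "\<And>e e'. e \<in> E \<Longrightarrow> e' \<in> E \<Longrightarrow> N.ip e e' = (if e = e' then 1 else 0)"
    using E by (auto simp: big_def N.orthonormal_def)
  have small: "\<mu> (\<lambda>a. (N.ip (\<xi> a) r)\<^sup>2) \<le> \<delta>"
    if b: "b \<in> X" and r: "r = N.residual E (\<xi> b)" for b r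
  proof -
    have rB: "r \<in> bounded_funs Y" unfolding r by (rule N.residual_bounded[OF on \<xi>B[OF b]])
    have orth: "N.ip r e = 0" if "e \<in> E" for e
      unfolding r by (rule N.residual_orthogonal[OF on \<xi>B[OF b] that])
    have r1: "N.ip r r \<le> 1"
      using N.ip_residual_self[OF on \<xi>B[OF b]] ip_\<xi>[OF b] sum_nonneg[of E "\<lambda>e. (N.ip (\<xi> b) e)\<^sup>2"]
      unfolding r by simp
    show ?thesis
    proof (cases "N.ip r r = 0")
      case True
      have "N.ip (\<xi> a) r = 0" if "a \<in> X" for a
        using N.cauchy_schwarz[OF \<xi>B[OF that] rB] True by simp
      then have "\<mu> (\<lambda>a. (N.ip (\<xi> a) r)\<^sup>2) = \<mu> (\<lambda>a. 0)"
        by (intro M.cong sq_bounded rB) simp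
      then show ?thesis using \<delta> M.const[of 0] by simp
    next
      case False
      then have pos: "0 < N.ip r r" using N.ip_nonneg[OF rB] by simp
      define n where "n = sqrt (N.ip r r)"
      have n: "0 < n" "n * n = N.ip r r" using pos by (simp_all add: n_def)
      define e where "e = (\<lambda>y. (1 / n) * r y)"
      have eB: "e \<in> bounded_funs Y" unfolding e_def by (rule bounded_funs_scale[OF rB])
      have ip_e: "N.ip e w = N.ip r w / n" if "w \<in> bounded_funs Y" for w
        unfolding e_def by (simp only: N.ip_scale[OF rB that]) simp
      have ee: "N.ip e e = 1"
      proof -
        have "N.ip e e = N.ip r r / n / n" using ip_e[OF eB] ip_e[OF rB] N.ip_commute[of r e] by simp
        also have "\<dots> = 1" unfolding n(2)[symmetric] using n(1) by simp
        finally show ?thesis .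
      qed
      have eE: "N.ip e e' = 0" "N.ip e' e = 0" if "e' \<in> E" for e'
        using ip_e[OF EB[OF that]] orth[OF that] N.ip_commute[of e' e] by simp_all
      have "e \<notin> E" using ee eE(1)[of e] by auto
      have "N.orthonormal (insert e E)"
        unfolding N.orthonormal_def using fin eB EB ee eE ipE \<open>e \<notin> E\<close> by auto
      moreover have "\<not> big (insert e E)"
        using max[of "insert e E"] fin \<open>e \<notin> E\<close> by auto
      ultimately have "\<mu> (\<lambda>a. (N.ip (\<xi> a) e)\<^sup>2) \<le> \<delta>"
        using E by (auto simp: big_def)
      have "N.ip (\<xi> a) r = n * N.ip (\<xi> a) e" if "a \<in> X" for a
        using ip_e[OF \<xi>B[OF that]] n(1) by (simp add: N.ip_commute[of "\<xi> a"])
      then have "\<mu> (\<lambda>a. (N.ip (\<xi> a) r)\<^sup>2) = \<mu> (\<lambda>a. N.ip r r * (N.ip (\<xi> a) e)\<^sup>2)"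
        by (intro M.cong sq_bounded rB) (simp add: n(2)[symmetric] power2_eq_square)
      also have "\<dots> = N.ip r r * \<mu> (\<lambda>a. (N.ip (\<xi> a) e)\<^sup>2)"
        by (rule M.scale[OF sq_bounded[OF eB]])
      also have "\<dots> \<le> 1 * \<delta>"
        using pos r1 \<delta> \<open>\<mu> (\<lambda>a. (N.ip (\<xi> a) e)\<^sup>2) \<le> \<delta>\<close>
        by (intro mult_mono' M.nonneg sq_bounded eB) auto
      finally show ?thesis by simp
    qed
  qed
  show ?thesis
  proof (intro exI[of _ E] exI[of _ "\<lambda>e a. N.ip (\<xi> a) e"] conjI ballI allI impI)
    show "finite E" by fact
    show "\<bar>N.ip (\<xi> a) e\<bar> \<le> 1" if "e \<in> E" "a \<in> X" for e a
    proof -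
      have "(N.ip (\<xi> a) e)\<^sup>2 \<le> 1"
        using N.cauchy_schwarz[OF \<xi>B[OF that(2)] EB[OF that(1)]] ipE[OF that(1) that(1)] ip_\<xi>[OF that(2)]
        by simp
      then show ?thesis by (simp add: abs_square_le_1)
    qed
    fix f :: "'a \<Rightarrow> real" and b
    assume f': "\<forall>a\<in>X. \<bar>f a\<bar> \<le> 1" and b: "b \<in> X"
    have f: "\<bar>f a\<bar> \<le> 1" if "a \<in> X" for a using f' that by blast
    define r where "r = N.residual E (\<xi> b)"
    have rB: "r \<in> bounded_funs Y" unfolding r_def by (rule N.residual_bounded[OF on \<xi>B[OF b]])
    have fB: "f \<in> bounded_funs X" using f by (rule bounded_funsI)
    have fe: "(\<lambda>a. f a * N.ip (\<xi> a) e) \<in> bounded_funs X" if "e \<in> E" for e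
      by (intro bounded_funs_mult fB ip_bounded EB that)
    have fr: "(\<lambda>a. f a * N.ip (\<xi> a) r) \<in> bounded_funs X"
      by (intro bounded_funs_mult fB ip_bounded rB)
    have split: "N.ip (\<xi> a) (\<xi> b) = (\<Sum>e\<in>E. N.ip (\<xi> b) e * N.ip (\<xi> a) e) + N.ip (\<xi> a) r"
      if "a \<in> X" for a
    proof -
      have "N.ip r (\<xi> a) = N.ip (\<xi> b) (\<xi> a) - (\<Sum>e\<in>E. N.ip (\<xi> b) e * N.ip e (\<xi> a))"
        unfolding r_def by (rule N.ip_residual[OF on \<xi>B[OF b] \<xi>B[OF that]])
      moreover have "N.ip e (\<xi> a) = N.ip (\<xi> a) e" for e by (rule N.ip_commute)
      then have "(\<Sum>e\<in>E. N.ip (\<xi> b) e * N.ip e (\<xi> a)) = (\<Sum>e\<in>E. N.ip (\<xi> b) e * N.ip (\<xi> a) e)"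
        by (intro sum.cong refl arg_cong2[of _ _ _ _ "(*)"])
      ultimately show ?thesis
        using N.ip_commute[of r "\<xi> a"] N.ip_commute[of "\<xi> a" "\<xi> b"] by linarith
    qed
    have "\<mu> (\<lambda>a. f a * \<nu> (\<lambda>y. \<xi> a y * \<xi> b y)) = \<mu> (\<lambda>a. f a * N.ip (\<xi> a) (\<xi> b))"
      by (simp add: N.ip_def)
    also have "\<dots> = \<mu> (\<lambda>a. (\<Sum>e\<in>E. N.ip (\<xi> b) e * (f a * N.ip (\<xi> a) e)) + f a * N.ip (\<xi> a) r)"
    proof (rule M.cong)
      show "(\<lambda>a. f a * N.ip (\<xi> a) (\<xi> b)) \<in> bounded_funs X"
        by (intro bounded_funs_mult fB ip_bounded \<xi>B b)
      show "f a * N.ip (\<xi> a) (\<xi> b) = (\<Sum>e\<in>E. N.ip (\<xi> b) e * (f a * N.ip (\<xi> a) e)) + f a * N.ip (\<xi> a) r"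
        if "a \<in> X" for a
        unfolding split[OF that] by (simp add: distrib_left sum_distrib_left mult.left_commute)
    qed
    also have "\<dots> = \<mu> (\<lambda>a. \<Sum>e\<in>E. N.ip (\<xi> b) e * (f a * N.ip (\<xi> a) e)) + \<mu> (\<lambda>a. f a * N.ip (\<xi> a) r)"
      by (intro M.add bounded_funs_sum bounded_funs_scale fe fr)
    also have "\<mu> (\<lambda>a. \<Sum>e\<in>E. N.ip (\<xi> b) e * (f a * N.ip (\<xi> a) e)) =
        (\<Sum>e\<in>E. \<mu> (\<lambda>a. N.ip (\<xi> b) e * (f a * N.ip (\<xi> a) e)))"
      by (intro M.sum fin bounded_funs_scale fe)
    also have "\<dots> = (\<Sum>e\<in>E. N.ip (\<xi> b) e * \<mu> (\<lambda>a. f a * N.ip (\<xi> a) e))"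
      by (intro sum.cong refl M.scale fe)
    finally have eq: "\<mu> (\<lambda>a. f a * \<nu> (\<lambda>y. \<xi> a y * \<xi> b y)) -
        (\<Sum>e\<in>E. N.ip (\<xi> b) e * \<mu> (\<lambda>a. f a * N.ip (\<xi> a) e)) = M.ip f (\<lambda>a. N.ip (\<xi> a) r)"
      by (simp add: M.ip_def)
    have "(M.ip f (\<lambda>a. N.ip (\<xi> a) r))\<^sup>2 \<le> M.ip f f * M.ip (\<lambda>a. N.ip (\<xi> a) r) (\<lambda>a. N.ip (\<xi> a) r)"
      by (intro M.cauchy_schwarz fB ip_bounded rB)
    also have "\<dots> \<le> 1 * \<delta>"
    proof (rule mult_mono')
      have "\<bar>f a * f a\<bar> \<le> 1" if "a \<in> X" for a
        unfolding abs_mult by (rule mult_le_one[OF f[OF that] abs_ge_zero f[OF that]])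
      then have "\<bar>M.ip f f\<bar> \<le> 1" unfolding M.ip_def by (rule M.abs_le)
      then show "M.ip f f \<le> 1" by simp
      show "M.ip (\<lambda>a. N.ip (\<xi> a) r) (\<lambda>a. N.ip (\<xi> a) r) \<le> \<delta>"
        using small[OF b r_def] by (simp add: M.ip_def power2_eq_square)
    qed (intro M.ip_nonneg fB ip_bounded rB)+
    finally have "\<bar>M.ip f (\<lambda>a. N.ip (\<xi> a) r)\<bar> \<le> \<epsilon>"
      using \<open>\<epsilon> > 0\<close> by (simp add: \<delta>_def abs_le_square_iff[symmetric])
    then show "\<bar>\<mu> (\<lambda>a. f a * \<nu> (\<lambda>y. \<xi> a y * \<xi> b y)) -
        (\<Sum>e\<in>E. N.ip (\<xi> b) e * \<mu> (\<lambda>a. f a * N.ip (\<xi> a) e))\<bar> \<le> \<epsilon>"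
      unfolding eq .
  qed
qed

section \<open>The compact group of a precompact invariant pseudometric\<close>

text \<open>
  The completion of a group in such a pseudometric is a compact group. It is realised concretely as a
  set of real functions on \<open>G\<close>, so that no quotients or equivalence classes of Cauchy sequences
  are needed: a point \<open>k\<close> of the completion is recorded by its distances \<open>k x\<close> to the
  elements \<open>x\<close> of \<open>G\<close>.
\<close>
locale precompact_invariant_pseudometric = group G
  for G :: "('a, 'm) monoid_scheme" (structure) +
  fixes D :: "'a \<Rightarrow> 'a \<Rightarrow> real"
  assumes refl: "x \<in> carrier G \<Longrightarrow> D x x = 0"
    and sym: "\<lbrakk>x \<in> carrier G; y \<in> carrier G\<rbrakk> \<Longrightarrow> D x y = D y x"
    and triangle: "\<lbrakk>x \<in> carrier G; y \<in> carrier G; z \<in> carrier G\<rbrakk> \<Longrightarrow> D x z \<le> D x y + D y z"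
    and left_invariant: "\<lbrakk>x \<in> carrier G; y \<in> carrier G; z \<in> carrier G\<rbrakk> \<Longrightarrow> D (z \<otimes> x) (z \<otimes> y) = D x y"
    and right_invariant: "\<lbrakk>x \<in> carrier G; y \<in> carrier G; z \<in> carrier G\<rbrakk> \<Longrightarrow> D (x \<otimes> z) (y \<otimes> z) = D x y"
    and precompact: "\<epsilon> > 0 \<Longrightarrow> \<exists>N. finite N \<and> N \<subseteq> carrier G \<and> (\<forall>x \<in> carrier G. \<exists>y \<in> N. D x y \<le> \<epsilon>)"
begin

lemma D_inv: "x \<in> carrier G \<Longrightarrow> y \<in> carrier G \<Longrightarrow> D (inv x) (inv y) = D x y"
proof -
  assume xy: "x \<in> carrier G" "y \<in> carrier G"
  have "D (inv x) (inv y) = D (inv x \<otimes> y) (inv y \<otimes> y)"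
    by (rule right_invariant[symmetric]) (use xy in simp_all)
  also have "\<dots> = D (x \<otimes> (inv x \<otimes> y)) (x \<otimes> (inv y \<otimes> y))"
    by (rule left_invariant[symmetric]) (use xy in simp_all)
  also have "x \<otimes> (inv x \<otimes> y) = y" using xy by (simp add: m_assoc[symmetric])
  also have "x \<otimes> (inv y \<otimes> y) = x" using xy by simp
  also have "D y x = D x y" by (rule sym[OF xy(2,1)])
  finally show ?thesis .
qed

text \<open>
  The functions that satisfy both triangle inequalities are the distance functions of the one-point
  extensions of \<open>G\<close> (Katetov functions); the last condition says that the new point is a limit of
  elements of \<open>G\<close>. Outside the carrier the functions are normalised to 0.
\<close>
definition completion :: "('a \<Rightarrow> real) set" where
  "completion = {k. (\<forall>x. x \<notin> carrier G \<longrightarrow> k x = 0) \<and>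
     (\<forall>x\<in>carrier G. \<forall>y\<in>carrier G. k x \<le> D x y + k y \<and> D x y \<le> k x + k y) \<and>
     (\<forall>\<epsilon>>0. \<exists>x\<in>carrier G. k x \<le> \<epsilon>)}"

lemma completionI:
  assumes "\<And>x. x \<notin> carrier G \<Longrightarrow> k x = 0"
    and "\<And>x y. x \<in> carrier G \<Longrightarrow> y \<in> carrier G \<Longrightarrow> k x \<le> D x y + k y"
    and "\<And>x y. x \<in> carrier G \<Longrightarrow> y \<in> carrier G \<Longrightarrow> D x y \<le> k x + k y"
    and "\<And>\<epsilon>. \<epsilon> > 0 \<Longrightarrow> \<exists>x\<in>carrier G. k x \<le> \<epsilon>"
  shows "k \<in> completion"
  unfolding completion_def using assms by blast

lemma completion_outside: "k \<in> completion \<Longrightarrow> x \<notin> carrier G \<Longrightarrow> k x = 0"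
  by (simp add: completion_def)

lemma
  assumes "k \<in> completion" "x \<in> carrier G" "y \<in> carrier G"
  shows completion_lipschitz: "k x \<le> D x y + k y" and completion_triangle: "D x y \<le> k x + k y"
  using assms by (simp_all add: completion_def)

lemma completion_nonneg: "k \<in> completion \<Longrightarrow> x \<in> carrier G \<Longrightarrow> 0 \<le> k x"
  using completion_triangle[of k x x] refl[of x] by simp

lemma completion_small:
  assumes "k \<in> completion" "\<epsilon> > 0"
  obtains x where "x \<in> carrier G" "k x \<le> \<epsilon>"
  using assms by (auto simp: completion_def)

lemma completion_eqI:
  assumes "k \<in> completion" "l \<in> completion"
    and "\<And>x \<epsilon>. x \<in> carrier G \<Longrightarrow> \<epsilon> > 0 \<Longrightarrow> \<bar>k x - l x\<bar> \<le> \<epsilon>"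
  shows "k = l"
proof
  fix x
  show "k x = l x"
  proof (cases "x \<in> carrier G")
    case True
    have "\<bar>k x - l x\<bar> \<le> 0 + e" if "e > 0" for e using assms(3)[OF True that] by simp
    then have "\<bar>k x - l x\<bar> \<le> 0" by (rule field_le_epsilon)
    then show ?thesis by simp
  qed (simp add: completion_outside[OF assms(1)] completion_outside[OF assms(2)])
qed

definition point :: "'a \<Rightarrow> 'a \<Rightarrow> real" where
  "point g x = (if x \<in> carrier G then D g x else 0)"

text \<open>
  The infimal convolution extends the multiplication of \<open>G\<close>: bi-invariance gives
  \<open>D (g h) x = (INF y. D g y + D h (y\<^sup>-\<^sup>1 x))\<close>, where the infimum is attained at \<open>y = g\<close>.
\<close>
definition conv :: "('a \<Rightarrow> real) \<Rightarrow> ('a \<Rightarrow> real) \<Rightarrow> 'a \<Rightarrow> real" where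
  "conv k l x = (if x \<in> carrier G then INF y\<in>carrier G. k y + l (inv y \<otimes> x) else 0)"

definition flip :: "('a \<Rightarrow> real) \<Rightarrow> 'a \<Rightarrow> real" where
  "flip k x = (if x \<in> carrier G then k (inv x) else 0)"

lemma point_in_completion: "g \<in> carrier G \<Longrightarrow> point g \<in> completion"
proof (rule completionI)
  assume g: "g \<in> carrier G"
  show "point g x \<le> D x y + point g y" if "x \<in> carrier G" "y \<in> carrier G" for x y
    using triangle[OF g that(2,1)] sym[OF that] that by (simp add: point_def)
  show "D x y \<le> point g x + point g y" if "x \<in> carrier G" "y \<in> carrier G" for x y
    using triangle[OF that(1) g that(2)] sym[OF that(1) g] that by (simp add: point_def)
  show "\<exists>x\<in>carrier G. point g x \<le> \<epsilon>" if "\<epsilon> > 0" for \<epsilon>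
    using that g refl[OF g] by (intro bexI[of _ g]) (simp_all add: point_def)
qed (simp add: point_def)

lemma flip_in_completion:
  assumes k: "k \<in> completion"
  shows "flip k \<in> completion"
proof (rule completionI)
  show "flip k x \<le> D x y + flip k y" if "x \<in> carrier G" "y \<in> carrier G" for x y
    using completion_lipschitz[OF k, of "inv x" "inv y"] that by (simp add: flip_def D_inv)
  show "D x y \<le> flip k x + flip k y" if "x \<in> carrier G" "y \<in> carrier G" for x y
    using completion_triangle[OF k, of "inv x" "inv y"] that by (simp add: flip_def D_inv)
  fix \<epsilon> :: real assume "\<epsilon> > 0"
  with k obtain x where x: "x \<in> carrier G" "k x \<le> \<epsilon>" by (rule completion_small)
  then show "\<exists>x\<in>carrier G. flip k x \<le> \<epsilon>" by (intro bexI[of _ "inv x"]) (simp_all add: flip_def)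
qed (simp add: flip_def)

text \<open>
  If \<open>k\<close> is close to the element \<open>y\<close>, then the product of \<open>k\<close> and \<open>l\<close> is close to the left
  translate of \<open>l\<close> by \<open>y\<close>. All group laws and the continuity of the multiplication are
  consequences of this estimate.
\<close>
lemma
  assumes k: "k \<in> completion" and l: "l \<in> completion" and x: "x \<in> carrier G" and y: "y \<in> carrier G"
  shows conv_le: "conv k l x \<le> k y + l (inv y \<otimes> x)"
    and conv_approx: "\<bar>conv k l x - l (inv y \<otimes> x)\<bar> \<le> k y"
proof -
  have "0 \<le> k y + l (inv y \<otimes> x)" if "y \<in> carrier G" for y
    using completion_nonneg[OF k that] completion_nonneg[OF l, of "inv y \<otimes> x"] that x by simp
  then have "bdd_below ((\<lambda>y. k y + l (inv y \<otimes> x)) ` carrier G)"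
    by (intro bdd_belowI[of _ 0]) auto
  then show le: "conv k l x \<le> k y + l (inv y \<otimes> x)"
    using cINF_lower[of "\<lambda>y. k y + l (inv y \<otimes> x)" "carrier G" y] x y by (simp add: conv_def)
  have "l (inv y \<otimes> x) - k y \<le> k z + l (inv z \<otimes> x)" if z: "z \<in> carrier G" for z
  proof -
    have "l (inv y \<otimes> x) \<le> D (inv y \<otimes> x) (inv z \<otimes> x) + l (inv z \<otimes> x)"
      using x y z by (intro completion_lipschitz[OF l]) auto
    also have "D (inv y \<otimes> x) (inv z \<otimes> x) = D y z" using x y z by (simp add: right_invariant D_inv)
    also have "D y z \<le> k y + k z" by (rule completion_triangle[OF k y z])
    finally show ?thesis by simp
  qed
  then have "l (inv y \<otimes> x) - k y \<le> conv k l x"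
    using x one_closed by (auto simp: conv_def intro!: cINF_greatest)
  with le show "\<bar>conv k l x - l (inv y \<otimes> x)\<bar> \<le> k y" by linarith
qed

lemma conv_product_le:
  assumes k: "k \<in> completion" and l: "l \<in> completion" and y: "y \<in> carrier G" and z: "z \<in> carrier G"
  shows "conv k l (y \<otimes> z) \<le> k y + l z"
  using conv_le[OF k l m_closed[OF y z] y] y z by (simp add: m_assoc[symmetric])

lemma conv_in_completion:
  assumes k: "k \<in> completion" and l: "l \<in> completion"
  shows "conv k l \<in> completion"
proof (rule completionI)
  show "conv k l x \<le> D x y + conv k l y" if x: "x \<in> carrier G" and y: "y \<in> carrier G" for x y
  proof (rule field_le_epsilon)
    fix e :: real assume "e > 0"
    then obtain z where z: "z \<in> carrier G" "k z \<le> e / 2" using completion_small[OF k, of "e / 2"] by auto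
    have "l (inv z \<otimes> x) \<le> D (inv z \<otimes> x) (inv z \<otimes> y) + l (inv z \<otimes> y)"
      using x y z by (intro completion_lipschitz[OF l]) auto
    then show "conv k l x \<le> D x y + conv k l y + e"
      using conv_approx[OF k l x z(1)] conv_approx[OF k l y z(1)] z x y by (simp add: left_invariant)
  qed
  show "D x y \<le> conv k l x + conv k l y" if x: "x \<in> carrier G" and y: "y \<in> carrier G" for x y
  proof (rule field_le_epsilon)
    fix e :: real assume "e > 0"
    then obtain z where z: "z \<in> carrier G" "k z \<le> e / 2" using completion_small[OF k, of "e / 2"] by auto
    have "D (inv z \<otimes> x) (inv z \<otimes> y) \<le> l (inv z \<otimes> x) + l (inv z \<otimes> y)"
      using x y z by (intro completion_triangle[OF l]) auto
    then show "D x y \<le> conv k l x + conv k l y + e"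
      using conv_approx[OF k l x z(1)] conv_approx[OF k l y z(1)] z x y by (simp add: left_invariant)
  qed
  fix \<epsilon> :: real assume "\<epsilon> > 0"
  then obtain y z where "y \<in> carrier G" "k y \<le> \<epsilon> / 2" "z \<in> carrier G" "l z \<le> \<epsilon> / 2"
    using completion_small[OF k, of "\<epsilon> / 2"] completion_small[OF l, of "\<epsilon> / 2"] by (metis half_gt_zero)
  then show "\<exists>x\<in>carrier G. conv k l x \<le> \<epsilon>"
    using conv_product_le[OF k l, of y z] by (intro bexI[of _ "y \<otimes> z"]) auto
qed (simp add: conv_def)

lemma conv_assoc:
  assumes k: "k \<in> completion" and l: "l \<in> completion" and m: "m \<in> completion"
  shows "conv (conv k l) m = conv k (conv l m)"
proof (rule completion_eqI)
  fix x and \<epsilon> :: real assume x: "x \<in> carrier G" and "\<epsilon> > 0"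
  then obtain y z where y: "y \<in> carrier G" "k y \<le> \<epsilon> / 4" and z: "z \<in> carrier G" "l z \<le> \<epsilon> / 4"
    using completion_small[OF k, of "\<epsilon> / 4"] completion_small[OF l, of "\<epsilon> / 4"]
    by (metis zero_less_divide_iff zero_less_numeral)
  have kl: "conv k l \<in> completion" and lm: "conv l m \<in> completion"
    using k l m by (simp_all add: conv_in_completion)
  have yx: "inv y \<otimes> x \<in> carrier G" using x y by simp
  have "inv (y \<otimes> z) \<otimes> x = inv z \<otimes> (inv y \<otimes> x)" using x y z by (simp add: inv_mult_group m_assoc)
  then show "\<bar>conv (conv k l) m x - conv k (conv l m) x\<bar> \<le> \<epsilon>"
    using conv_approx[OF k lm x y(1)] conv_approx[OF l m yx z(1)]
      conv_approx[OF kl m x m_closed[OF y(1) z(1)]] conv_product_le[OF k l y(1) z(1)] y(2) z(2)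
    by simp
qed (use assms in \<open>simp_all add: conv_in_completion\<close>)

lemma conv_point:
  assumes g: "g \<in> carrier G" and l: "l \<in> completion" and x: "x \<in> carrier G"
  shows "conv (point g) l x = l (inv g \<otimes> x)"
  using conv_approx[OF point_in_completion[OF g] l x g] refl[OF g] g by (simp add: point_def)

lemma conv_flip:
  assumes k: "k \<in> completion"
  shows "conv (flip k) k = point \<one>"
proof (rule completion_eqI)
  fix x and \<epsilon> :: real assume x: "x \<in> carrier G" and "\<epsilon> > 0"
  then obtain y where y: "y \<in> carrier G" "k y \<le> \<epsilon> / 2" using completion_small[OF k, of "\<epsilon> / 2"] by auto
  have yx: "y \<otimes> x \<in> carrier G" using x y by simp
  have D: "D (y \<otimes> x) y = D \<one> x"
    using left_invariant[of x \<one> y] x y sym[of x \<one>] by simp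
  have "\<bar>conv (flip k) k x - k (y \<otimes> x)\<bar> \<le> k y"
    using conv_approx[OF flip_in_completion[OF k] k x inv_closed[OF y(1)]] y by (simp add: flip_def)
  moreover have "k (y \<otimes> x) \<le> D \<one> x + k y" "D \<one> x \<le> k (y \<otimes> x) + k y"
    using completion_lipschitz[OF k yx y(1)] completion_triangle[OF k yx y(1)] D by simp_all
  ultimately show "\<bar>conv (flip k) k x - point \<one> x\<bar> \<le> \<epsilon>" using x y(2) by (simp add: point_def)
qed (use k in \<open>simp_all add: conv_in_completion flip_in_completion point_in_completion\<close>)

definition completion_group :: "('a \<Rightarrow> real) monoid" where
  "completion_group = \<lparr>carrier = completion, monoid.mult = conv, one = point \<one>\<rparr>"

lemma group_completion: "group completion_group"
proof (rule groupI)
  show "\<one>\<^bsub>completion_group\<^esub> \<otimes>\<^bsub>completion_group\<^esub> l = l" if "l \<in> carrier completion_group" for l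
  proof
    fix x show "(\<one>\<^bsub>completion_group\<^esub> \<otimes>\<^bsub>completion_group\<^esub> l) x = l x"
      using that conv_point[of \<one> l x] completion_outside[of l x]
      by (cases "x \<in> carrier G") (simp_all add: completion_group_def conv_def)
  qed
  show "\<exists>l\<in>carrier completion_group. l \<otimes>\<^bsub>completion_group\<^esub> k = \<one>\<^bsub>completion_group\<^esub>"
    if "k \<in> carrier completion_group" for k
    using that conv_flip[of k] flip_in_completion[of k]
    by (intro bexI[of _ "flip k"]) (simp_all add: completion_group_def)
qed (simp_all add: completion_group_def conv_in_completion conv_assoc point_in_completion)

lemma inv_completion: "k \<in> completion \<Longrightarrow> inv\<^bsub>completion_group\<^esub> k = flip k"
  by (rule group.inv_equality[OF group_completion])
    (simp_all add: completion_group_def conv_flip flip_in_completion)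

lemma point_hom: "point \<in> hom G completion_group"
proof (rule homI)
  show "point x \<in> carrier completion_group" if "x \<in> carrier G" for x
    using point_in_completion[OF that] by (simp add: completion_group_def)
  show "point (g \<otimes> h) = point g \<otimes>\<^bsub>completion_group\<^esub> point h" if g: "g \<in> carrier G" and h: "h \<in> carrier G" for g h
  proof
    fix x
    show "point (g \<otimes> h) x = (point g \<otimes>\<^bsub>completion_group\<^esub> point h) x"
    proof (cases "x \<in> carrier G")
      case True
      have "D (g \<otimes> h) x = D (g \<otimes> h) (g \<otimes> (inv g \<otimes> x))"
        using True g by (simp add: m_assoc[symmetric])
      also have "\<dots> = D h (inv g \<otimes> x)" using True g h by (simp add: left_invariant)
      finally show ?thesis
        using True g h conv_point[OF g point_in_completion[OF h] True]
        by (simp add: completion_group_def point_def)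
    qed (simp add: completion_group_def point_def conv_def)
  qed
qed

text \<open>
  In the topology of pointwise convergence the set is contained in a product of compact intervals,
  so it remains to see that it is closed. Only the condition \<open>inf k = 0\<close> is not visibly closed;
  precompactness allows to test it on a finite net, as in the set \<open>C'\<close> below.
\<close>
lemma compact_completion: "compact completion"
proof -
  obtain net where net: "\<And>\<epsilon>. \<epsilon> > 0 \<Longrightarrow> finite (net \<epsilon>) \<and> net \<epsilon> \<subseteq> carrier G \<and>
      (\<forall>x\<in>carrier G. \<exists>y\<in>net \<epsilon>. D x y \<le> \<epsilon>)"
    using precompact by metis
  have near: "\<exists>y\<in>net \<epsilon>. k y \<le> 2 * \<epsilon>" if k: "k \<in> completion" and "\<epsilon> > 0" for k \<epsilon>
  proof -
    obtain x where x: "x \<in> carrier G" "k x \<le> \<epsilon>" using completion_small[OF k \<open>\<epsilon> > 0\<close>] .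
    obtain y where y: "y \<in> net \<epsilon>" "D x y \<le> \<epsilon>" using net[OF \<open>\<epsilon> > 0\<close>] x(1) by blast
    then have "y \<in> carrier G" using net[OF \<open>\<epsilon> > 0\<close>] by blast
    then have "k y \<le> 2 * \<epsilon>" using completion_lipschitz[OF k, of y x] sym[of x y] x y by simp
    with y(1) show ?thesis by blast
  qed
  define b where "b x = (if x \<in> carrier G then 2 + (\<Sum>y\<in>net 1. D x y) else 0)" for x
  define C where "C = {k :: 'a \<Rightarrow> real. (\<forall>x. x \<in> - carrier G \<longrightarrow> k x = 0) \<and>
      (\<forall>x. x \<in> carrier G \<longrightarrow> (\<forall>y. y \<in> carrier G \<longrightarrow> k x \<le> D x y + k y \<and> D x y \<le> k x + k y))}"
  define C' where "C' = (\<Inter>\<epsilon>\<in>{0<..}. \<Union>y\<in>net \<epsilon>. {k :: 'a \<Rightarrow> real. k y \<le> 2 * \<epsilon>})"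
  have ev: "continuous_on UNIV (\<lambda>k :: 'a \<Rightarrow> real. k x)" for x by simp
  have "closed C"
    unfolding C_def
    by (intro closed_Collect_conj closed_Collect_all closed_Collect_imp open_Collect_const
        closed_Collect_eq closed_Collect_le continuous_on_add continuous_on_const ev)
  moreover have "closed C'"
    unfolding C'_def using net
    by (intro closed_INT ballI closed_UN closed_Collect_le continuous_on_const ev) auto
  ultimately have "closed (C \<inter> C')" by (rule closed_Int)
  moreover have "completion = {k. \<forall>x. \<bar>k x\<bar> \<le> b x} \<inter> (C \<inter> C')"
  proof (intro equalityI subsetI IntI)
    fix k assume k: "k \<in> completion"
    show "k \<in> C" using k unfolding C_def completion_def by blast
    show "k \<in> C'" using near[OF k] unfolding C'_def by blast
    show "k \<in> {k. \<forall>x. \<bar>k x\<bar> \<le> b x}"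
    proof (intro CollectI allI)
      fix x show "\<bar>k x\<bar> \<le> b x"
      proof (cases "x \<in> carrier G")
        case True
        obtain y where y: "y \<in> net 1" "k y \<le> 2" using near[OF k, of 1] by auto
        have n: "finite (net 1)" "\<And>y. y \<in> net 1 \<Longrightarrow> y \<in> carrier G" using net[of 1] by auto
        have D0: "0 \<le> D x y" if "y \<in> carrier G" for y
          using triangle[of x y x] True that refl[of x] sym[of x y] by simp
        have "D x y \<le> (\<Sum>y\<in>net 1. D x y)"
          using y(1) n D0 by (intro member_le_sum) auto
        then show ?thesis
          using completion_lipschitz[OF k True n(2)[OF y(1)]] y(2) completion_nonneg[OF k True] True
          by (simp add: b_def)
      qed (simp add: b_def completion_outside[OF k])
    qed
  next
    fix k assume "k \<in> {k. \<forall>x. \<bar>k x\<bar> \<le> b x} \<inter> (C \<inter> C')"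
    then have k: "k \<in> C" "k \<in> C'" by simp_all
    show "k \<in> completion"
    proof (rule completionI)
      fix \<epsilon> :: real assume e: "\<epsilon> > 0"
      then have "\<epsilon> / 2 \<in> {0<..}" by simp
      then have "k \<in> (\<Union>y\<in>net (\<epsilon> / 2). {k. k y \<le> 2 * (\<epsilon> / 2)})"
        using k(2) unfolding C'_def by (rule INT_D[rotated])
      then show "\<exists>x\<in>carrier G. k x \<le> \<epsilon>" using net[of "\<epsilon> / 2"] e by auto
    qed (use k(1) in \<open>auto simp: C_def\<close>)
  qed
  ultimately show ?thesis
    using compact_Int_closed[OF compact_functions_bounded_by[of b]] by simp
qed

text \<open>
  Near \<open>(k0, l0)\<close>, the value of the product at \<open>x\<close> is controlled by two coordinates only: \<open>k y\<close> and
  \<open>l (y\<^sup>-\<^sup>1 x)\<close>, where \<open>y\<close> is chosen with \<open>k0 y\<close> small.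
\<close>
lemma continuous_conv: "continuous_on (completion \<times> completion) (\<lambda>(k, l). conv k l)"
proof (rule continuous_on_coordinatewise_then_product)
  fix x
  show "continuous_on (completion \<times> completion) (\<lambda>p. (case p of (k, l) \<Rightarrow> conv k l) x)"
  proof (cases "x \<in> carrier G")
    case False
    then have "(\<lambda>p. (case p of (k, l) \<Rightarrow> conv k l) x) = (\<lambda>p. 0)" by (auto simp: conv_def)
    then show ?thesis by (simp only: continuous_on_const)
  next
    case x: True
    show ?thesis
      unfolding continuous_on_def
    proof (intro ballI tendstoI)
      fix p and \<epsilon> :: real assume p: "p \<in> completion \<times> completion" and e: "\<epsilon> > 0"
      let ?F = "at p within completion \<times> completion"
      obtain k0 l0 where p0: "p = (k0, l0)" "k0 \<in> completion" "l0 \<in> completion" using p by auto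
      obtain y where y: "y \<in> carrier G" "k0 y \<le> \<epsilon> / 4" using completion_small[OF p0(2), of "\<epsilon> / 4"] e by auto
      let ?w = "inv y \<otimes> x"
      have t1: "((\<lambda>q. fst q y) \<longlongrightarrow> fst p y) ?F" and t2: "((\<lambda>q. snd q ?w) \<longlongrightarrow> snd p ?w) ?F"
      proof -
        have "continuous_on (completion \<times> completion) (\<lambda>q :: ('a \<Rightarrow> real) \<times> ('a \<Rightarrow> real). fst q y)"
          by (rule continuous_on_product_then_coordinatewise) (intro continuous_intros)
        moreover have "continuous_on (completion \<times> completion) (\<lambda>q :: ('a \<Rightarrow> real) \<times> ('a \<Rightarrow> real). snd q ?w)"
          by (rule continuous_on_product_then_coordinatewise) (intro continuous_intros)
        ultimately show "((\<lambda>q. fst q y) \<longlongrightarrow> fst p y) ?F" "((\<lambda>q. snd q ?w) \<longlongrightarrow> snd p ?w) ?F"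
          using p unfolding continuous_on_def by blast+
      qed
      have "\<forall>\<^sub>F q in ?F. fst q y < \<epsilon> / 2"
        using order_tendstoD(2)[OF t1, of "\<epsilon> / 2"] y(2) p0(1) e by simp
      moreover have "\<forall>\<^sub>F q in ?F. dist (snd q ?w) (snd p ?w) < \<epsilon> / 4"
        using tendstoD[OF t2, of "\<epsilon> / 4"] e by simp
      moreover have "\<forall>\<^sub>F q in ?F. q \<in> completion \<times> completion"
        by (simp add: eventually_at_filter)
      ultimately show "\<forall>\<^sub>F q in ?F. dist ((case q of (k, l) \<Rightarrow> conv k l) x) ((case p of (k, l) \<Rightarrow> conv k l) x) < \<epsilon>"
      proof eventually_elim
        case (elim q)
        then obtain k l where q: "q = (k, l)" "k \<in> completion" "l \<in> completion" by auto
        have "\<bar>conv k l x - l ?w\<bar> \<le> k y" "\<bar>conv k0 l0 x - l0 ?w\<bar> \<le> k0 y"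
          using conv_approx x y(1) q p0 by auto
        moreover have "k y < \<epsilon> / 2" "\<bar>l ?w - l0 ?w\<bar> < \<epsilon> / 4"
          using elim(1,2) q(1) p0(1) by (simp_all add: dist_real_def)
        ultimately have "\<bar>conv k l x - conv k0 l0 x\<bar> < \<epsilon>" using y(2) by linarith
        then show ?case by (simp add: q(1) p0(1) dist_real_def)
      qed
    qed
  qed
qed

lemma continuous_flip: "continuous_on completion flip"
proof (rule continuous_on_coordinatewise_then_product)
  fix x
  show "continuous_on completion (\<lambda>k. flip k x)"
    by (cases "x \<in> carrier G") (simp_all add: flip_def continuous_on_subset[OF continuous_on_product_coordinates])
qed

lemma compact_hausdorff_completion: "compact_hausdorff_group completion_group (top_of_set completion)"
proof -
  interpret K: group completion_group by (rule group_completion)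
  show ?thesis
  proof
    show "topspace (top_of_set completion) = carrier completion_group" by (simp add: completion_group_def)
    show "compact_space (top_of_set completion)"
      using compact_completion by (simp add: compact_space_subtopology)
    show "Hausdorff_space (top_of_set completion)"
    proof (rule Hausdorff_space_subtopology)
      show "Hausdorff_space (euclidean :: ('a \<Rightarrow> real) topology)"
        unfolding euclidean_product_topology[symmetric] by (simp add: Hausdorff_space_product_topology)
    qed
    show "continuous_map (prod_topology (top_of_set completion) (top_of_set completion)) (top_of_set completion)
        (\<lambda>(k, l). k \<otimes>\<^bsub>completion_group\<^esub> l)"
      using continuous_conv conv_in_completion by (auto simp: completion_group_def)
    have "continuous_map (top_of_set completion) (top_of_set completion) flip"
      using continuous_flip flip_in_completion by auto
    then show "continuous_map (top_of_set completion) (top_of_set completion) (\<lambda>k. inv\<^bsub>completion_group\<^esub> k)"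
      by (rule continuous_map_eq) (simp add: inv_completion)
  qed
qed

text \<open>
  By the universal property, \<open>x \<mapsto> D x \<cdot>\<close> extends to a continuous homomorphism from the Bohr
  compactification to the completion, and evaluation at the unit is continuous there.
\<close>
theorem bohr_open_ball:
  assumes bG: "bohr_compactification G bG T \<eta>"
  shows "openin (bohr_topology G T \<eta>) {x \<in> carrier G. D x \<one> < \<epsilon>}"
proof -
  have "factors_uniquely G bG T \<eta> completion_group (top_of_set completion)"
    by (rule bohr_compactification_universal[OF is_group bG compact_hausdorff_completion])
  from ex1_implies_ex[OF bspec[OF this[unfolded factors_uniquely_def] point_hom]]
  obtain g where g: "continuous_map T (top_of_set completion) g" "\<And>x. x \<in> carrier G \<Longrightarrow> g (\<eta> x) = point x"
    by blast
  have "continuous_map (top_of_set completion) euclideanreal (\<lambda>k. k \<one>)"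
    by (simp add: continuous_on_subset[OF continuous_on_product_coordinates])
  with g(1) have "continuous_map T euclideanreal (\<lambda>b. g b \<one>)"
    using continuous_map_compose[of T "top_of_set completion" g euclideanreal "\<lambda>k. k \<one>"] by (simp add: o_def)
  then have "openin T {b \<in> topspace T. g b \<one> \<in> {..<\<epsilon>}}"
    by (rule openin_continuous_map_preimage) simp
  moreover have "{x \<in> carrier G. D x \<one> < \<epsilon>} = \<eta> -` {b \<in> topspace T. g b \<one> \<in> {..<\<epsilon>}} \<inter> carrier G"
  proof -
    have "\<eta> x \<in> topspace T" if "x \<in> carrier G" for x
      using bG that by (auto simp: bohr_compactification_def hom_def compact_hausdorff_group_def
          compact_hausdorff_group_axioms_def)
    then show ?thesis using g(2) by (auto simp: point_def)
  qed
  ultimately show ?thesis unfolding bohr_topology_def openin_pullback_topology by blast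
qed

end

section \<open>Almost periodic functions\<close>

lemma finite_image_representatives:
  assumes "finite (p ` X)"
  shows "\<exists>N. finite N \<and> N \<subseteq> X \<and> (\<forall>x\<in>X. \<exists>y\<in>N. p x = p y)"
proof -
  obtain N where N: "N \<subseteq> X" "finite N" "p ` X = p ` N"
    using finite_subset_image[OF assms order_refl] by blast
  have "\<exists>y\<in>N. p x = p y" if "x \<in> X" for x
    using imageI[OF that, of p] unfolding N(3) by blast
  with N(1,2) show ?thesis by blast
qed

text \<open>
  The condition says that the functions \<open>k \<mapsto> F (k g)\<close>, for \<open>g\<close> in the group, form a precompact set in the
  uniform norm.
\<close>
definition (in group) almost_periodic :: "('a \<Rightarrow> real) \<Rightarrow> bool" where
  "almost_periodic F \<longleftrightarrow> F \<in> bounded_funs (carrier G) \<and>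
     (\<forall>\<epsilon>>0. \<exists>N. finite N \<and> N \<subseteq> carrier G \<and>
        (\<forall>g\<in>carrier G. \<exists>h\<in>N. \<forall>k\<in>carrier G. \<bar>F (k \<otimes> g) - F (k \<otimes> h)\<bar> \<le> \<epsilon>))"

text \<open>
  The supremum of \<open>\<bar>F (k g x) - F (k h x)\<bar>\<close> over all \<open>k\<close> and \<open>x\<close> is a bi-invariant pseudometric
  that dominates \<open>\<bar>F g - F h\<bar>\<close>. To see that it is precompact, replace \<open>x\<close> by an element \<open>y\<close> of a
  finite net \<open>N\<close>, and then \<open>g y\<close> by its neighbour in \<open>N\<close>: up to a small error, \<open>g\<close> only
  matters through the resulting map from \<open>N\<close> to \<open>N\<close>, and there are finitely many of these.
\<close>
theorem (in group) almost_periodic_bohr_continuous: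
  assumes bG: "bohr_compactification G bG T \<eta>" and F: "almost_periodic F" and "\<epsilon> > 0"
  shows "\<exists>U. openin (bohr_topology G T \<eta>) U \<and> \<one> \<in> U \<and> U \<subseteq> carrier G \<and>
    (\<forall>x\<in>U. \<bar>F x - F \<one>\<bar> < \<epsilon>)"
proof -
  obtain C where C: "\<And>x. x \<in> carrier G \<Longrightarrow> \<bar>F x\<bar> \<le> C"
    using F unfolding almost_periodic_def bounded_funs_def by blast
  have ap: "\<exists>N. finite N \<and> N \<subseteq> carrier G \<and>
      (\<forall>g\<in>carrier G. \<exists>h\<in>N. \<forall>k\<in>carrier G. \<bar>F (k \<otimes> g) - F (k \<otimes> h)\<bar> \<le> e)" if "e > 0" for e
    using F that unfolding almost_periodic_def by blast
  define d where "d g h p = \<bar>F (fst p \<otimes> g \<otimes> snd p) - F (fst p \<otimes> h \<otimes> snd p)\<bar>" for g h p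
  define D where "D g h = (SUP p\<in>carrier G \<times> carrier G. d g h p)" for g h
  have D_upper: "\<bar>F (k \<otimes> g \<otimes> x) - F (k \<otimes> h \<otimes> x)\<bar> \<le> D g h"
    if "g \<in> carrier G" "h \<in> carrier G" "k \<in> carrier G" "x \<in> carrier G" for g h k x
  proof -
    have "d g h p \<le> 2 * C" if "p \<in> carrier G \<times> carrier G" for p
    proof -
      have "\<bar>F (fst p \<otimes> g \<otimes> snd p)\<bar> \<le> C" "\<bar>F (fst p \<otimes> h \<otimes> snd p)\<bar> \<le> C"
        using that \<open>g \<in> carrier G\<close> \<open>h \<in> carrier G\<close> by (auto intro!: C)
      then show ?thesis unfolding d_def by linarith
    qed
    then have "bdd_above (d g h ` (carrier G \<times> carrier G))" by (rule bdd_aboveI2)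
    moreover have "(k, x) \<in> carrier G \<times> carrier G" using that by simp
    ultimately have "d g h (k, x) \<le> D g h" unfolding D_def by (rule cSUP_upper[rotated])
    then show ?thesis by (simp add: d_def)
  qed
  have D_least: "D g h \<le> c"
    if c: "\<And>k x. k \<in> carrier G \<Longrightarrow> x \<in> carrier G \<Longrightarrow> \<bar>F (k \<otimes> g \<otimes> x) - F (k \<otimes> h \<otimes> x)\<bar> \<le> c" for g h c
    unfolding D_def
  proof (rule cSUP_least)
    show "carrier G \<times> carrier G \<noteq> {}" using one_closed by blast
    show "d g h p \<le> c" if "p \<in> carrier G \<times> carrier G" for p
      using that c[of "fst p" "snd p"] by (auto simp: d_def)
  qed
  interpret precompact_invariant_pseudometric G D
  proof unfold_locales
    show "D x x = 0" if x: "x \<in> carrier G" for x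
    proof (rule antisym)
      show "D x x \<le> 0" by (rule D_least) simp
      show "0 \<le> D x x" using D_upper[OF x x one_closed one_closed] by simp
    qed
    show "D x y = D y x" for x y
      unfolding D_def d_def by (simp add: abs_minus_commute)
    show "D x z \<le> D x y + D y z" if "x \<in> carrier G" "y \<in> carrier G" "z \<in> carrier G" for x y z
    proof (rule D_least)
      fix k w assume kw: "k \<in> carrier G" "w \<in> carrier G"
      show "\<bar>F (k \<otimes> x \<otimes> w) - F (k \<otimes> z \<otimes> w)\<bar> \<le> D x y + D y z"
        using D_upper[OF that(1,2) kw] D_upper[OF that(2,3) kw] by linarith
    qed
    have left: "D (z \<otimes> x) (z \<otimes> y) \<le> D x y"
      if x: "x \<in> carrier G" and y: "y \<in> carrier G" and z: "z \<in> carrier G" for x y z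
    proof (rule D_least)
      fix k w assume kw: "k \<in> carrier G" "w \<in> carrier G"
      show "\<bar>F (k \<otimes> (z \<otimes> x) \<otimes> w) - F (k \<otimes> (z \<otimes> y) \<otimes> w)\<bar> \<le> D x y"
        using D_upper[OF x y m_closed[OF kw(1) z] kw(2)] x y z kw by (simp add: m_assoc)
    qed
    show "D (z \<otimes> x) (z \<otimes> y) = D x y"
      if x: "x \<in> carrier G" and y: "y \<in> carrier G" and z: "z \<in> carrier G" for x y z
    proof (rule antisym[OF left[OF that]])
      have "inv z \<otimes> (z \<otimes> x) = x" "inv z \<otimes> (z \<otimes> y) = y" using x y z by (simp_all add: m_assoc[symmetric])
      then show "D x y \<le> D (z \<otimes> x) (z \<otimes> y)" using left[of "z \<otimes> x" "z \<otimes> y" "inv z"] x y z by simp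
    qed
    have right: "D (x \<otimes> z) (y \<otimes> z) \<le> D x y"
      if x: "x \<in> carrier G" and y: "y \<in> carrier G" and z: "z \<in> carrier G" for x y z
    proof (rule D_least)
      fix k w assume kw: "k \<in> carrier G" "w \<in> carrier G"
      show "\<bar>F (k \<otimes> (x \<otimes> z) \<otimes> w) - F (k \<otimes> (y \<otimes> z) \<otimes> w)\<bar> \<le> D x y"
        using D_upper[OF x y kw(1) m_closed[OF z kw(2)]] x y z kw by (simp add: m_assoc)
    qed
    show "D (x \<otimes> z) (y \<otimes> z) = D x y"
      if x: "x \<in> carrier G" and y: "y \<in> carrier G" and z: "z \<in> carrier G" for x y z
    proof (rule antisym[OF right[OF that]])
      have "x \<otimes> z \<otimes> inv z = x" "y \<otimes> z \<otimes> inv z = y" using x y z by (simp_all add: m_assoc)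
      then show "D x y \<le> D (x \<otimes> z) (y \<otimes> z)" using right[of "x \<otimes> z" "y \<otimes> z" "inv z"] x y z by simp
    qed
    fix e :: real assume "e > 0"
    then obtain N where N: "finite N" "N \<subseteq> carrier G"
      and net: "\<And>g. g \<in> carrier G \<Longrightarrow> \<exists>h\<in>N. \<forall>k\<in>carrier G. \<bar>F (k \<otimes> g) - F (k \<otimes> h)\<bar> \<le> e / 4"
      using ap[of "e / 4"] by auto
    \<comment> \<open>Four replacements of an argument of \<open>F\<close> by a neighbour, with error \<open>e / 4\<close> each, compare \<open>g\<close> with \<open>h\<close>.\<close>
    define near where "near g = (SOME h. h \<in> N \<and> (\<forall>k\<in>carrier G. \<bar>F (k \<otimes> g) - F (k \<otimes> h)\<bar> \<le> e / 4))" for g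
    have near: "near g \<in> N \<and> (\<forall>k\<in>carrier G. \<bar>F (k \<otimes> g) - F (k \<otimes> near g)\<bar> \<le> e / 4)"
      if "g \<in> carrier G" for g
    proof -
      have "\<exists>h. h \<in> N \<and> (\<forall>k\<in>carrier G. \<bar>F (k \<otimes> g) - F (k \<otimes> h)\<bar> \<le> e / 4)"
        using net[OF that] by blast
      from someI_ex[OF this] show ?thesis unfolding near_def .
    qed
    have NG: "x \<in> carrier G" if "x \<in> N" for x using that N(2) by blast
    define p where "p g = (\<lambda>x\<in>N. near (g \<otimes> x))" for g
    have "p ` carrier G \<subseteq> N \<rightarrow>\<^sub>E N" using near NG by (auto simp: p_def)
    moreover have "finite (N \<rightarrow>\<^sub>E N)" using N(1) by (intro finite_PiE) auto
    ultimately have "finite (p ` carrier G)" by (rule finite_subset)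
    from finite_image_representatives[OF this]
    obtain R where R: "finite R" "R \<subseteq> carrier G" "\<And>x. x \<in> carrier G \<Longrightarrow> \<exists>y\<in>R. p x = p y"
      by blast
    have close: "D g h \<le> e" if g: "g \<in> carrier G" and h: "h \<in> carrier G" and gh: "p g = p h" for g h
    proof (rule D_least)
      fix k x assume k: "k \<in> carrier G" and x: "x \<in> carrier G"
      define y where "y = near x"
      have y: "y \<in> N" "y \<in> carrier G" using near[OF x] NG by (auto simp: y_def)
      have xy: "\<bar>F (k \<otimes> g \<otimes> x) - F (k \<otimes> g \<otimes> y)\<bar> \<le> e / 4" "\<bar>F (k \<otimes> h \<otimes> x) - F (k \<otimes> h \<otimes> y)\<bar> \<le> e / 4"
        using near[OF x] k g h unfolding y_def by simp_all
      have eq: "near (g \<otimes> y) = near (h \<otimes> y)" using fun_cong[OF gh, of y] y(1) by (simp add: p_def)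
      have "\<bar>F (k \<otimes> g \<otimes> y) - F (k \<otimes> near (g \<otimes> y))\<bar> \<le> e / 4"
        "\<bar>F (k \<otimes> h \<otimes> y) - F (k \<otimes> near (g \<otimes> y))\<bar> \<le> e / 4"
        using near[of "g \<otimes> y"] near[of "h \<otimes> y"] eq k g h y(2) by (simp_all add: m_assoc)
      with xy show "\<bar>F (k \<otimes> g \<otimes> x) - F (k \<otimes> h \<otimes> x)\<bar> \<le> e" by linarith
    qed
    show "\<exists>N. finite N \<and> N \<subseteq> carrier G \<and> (\<forall>x\<in>carrier G. \<exists>y\<in>N. D x y \<le> e)"
    proof (intro exI[of _ R] conjI ballI)
      fix x assume x: "x \<in> carrier G"
      then obtain y where y: "y \<in> R" "p x = p y" using R(3) by blast
      have "D x y \<le> e" by (rule close[OF x subsetD[OF R(2) y(1)] y(2)])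
      with y(1) show "\<exists>y\<in>R. D x y \<le> e" by (rule rev_bexI)
    qed (rule R)+
  qed
  show ?thesis
  proof (intro exI[of _ "{x \<in> carrier G. D x \<one> < \<epsilon>}"] conjI ballI)
    show "openin (bohr_topology G T \<eta>) {x \<in> carrier G. D x \<one> < \<epsilon>}" by (rule bohr_open_ball[OF bG])
    show "\<bar>F x - F \<one>\<bar> < \<epsilon>" if "x \<in> {x \<in> carrier G. D x \<one> < \<epsilon>}" for x
      using that D_upper[of x \<one> \<one> \<one>] by auto
  qed (use \<open>\<epsilon> > 0\<close> in \<open>auto simp: refl\<close>)
qed

section \<open>The product set\<close>

text \<open>
  Let \<open>S\<close> be a subset of \<open>A\<close> with pairwise correlations below \<open>\<epsilon>\<close>. If it has \<open>n\<close> elements, then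
  \<open>(n \<beta>)\<^sup>2 \<le> \<nu> (\<Sum>s. \<xi> s)\<^sup>2 \<le> \<langle>\<Sum>s. \<xi> s, \<Sum>s. \<xi> s\<rangle> \<le> n + n\<^sup>2 \<epsilon>\<close>, which bounds \<open>n\<close> once \<open>\<epsilon> < \<beta>\<^sup>2\<close>. Hence a
  set \<open>S\<close> of maximal size exists. Each \<open>a \<in> A\<close> is then correlated by at least \<open>\<epsilon>\<close> with a member of
  \<open>S\<close>, so \<open>\<epsilon> \<mu>(A)\<close> is at most the sum over the finite set \<open>S\<close> of the means in question, one of
  which must be positive.
\<close>
lemma positive_correlation:
  fixes \<xi> :: "'a \<Rightarrow> 'b \<Rightarrow> real"
  assumes \<mu>: "mean_functional X \<mu>" and \<nu>: "mean_functional Y \<nu>"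
    and \<xi>: "\<And>a y. a \<in> X \<Longrightarrow> y \<in> Y \<Longrightarrow> 0 \<le> \<xi> a y \<and> \<xi> a y \<le> 1"
    and \<beta>: "\<beta> > 0" "\<And>a. a \<in> X \<Longrightarrow> \<beta> \<le> \<nu> (\<xi> a)"
    and A: "A \<subseteq> X" "0 < \<mu> (indicat_real A)"
  shows "\<exists>s\<in>A. 0 < \<mu> (\<lambda>a. indicat_real A a * \<nu> (\<lambda>y. \<xi> a y * \<xi> s y))"
proof -
  interpret M: mean_functional X \<mu> by fact
  interpret N: mean_functional Y \<nu> by fact
  define \<kappa> where "\<kappa> a b = N.ip (\<xi> a) (\<xi> b)" for a b
  define \<epsilon> where "\<epsilon> = \<beta>\<^sup>2 / 2"
  have \<epsilon>: "\<epsilon> > 0" using \<beta>(1) by (simp add: \<epsilon>_def)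
  have abs_\<xi>: "\<bar>\<xi> a y\<bar> \<le> 1" if "a \<in> X" "y \<in> Y" for a y using \<xi>[OF that] by simp
  have \<xi>B: "\<xi> a \<in> bounded_funs Y" if "a \<in> X" for a using abs_\<xi>[OF that] by (rule bounded_funsI)
  have \<kappa>_abs: "\<bar>\<kappa> a b\<bar> \<le> 1" if "a \<in> X" "b \<in> X" for a b
    unfolding \<kappa>_def N.ip_def
  proof (rule N.abs_le)
    show "\<bar>\<xi> a y * \<xi> b y\<bar> \<le> 1" if "y \<in> Y" for y
      unfolding abs_mult
      by (rule mult_le_one[OF abs_\<xi>[OF \<open>a \<in> X\<close> that] abs_ge_zero abs_\<xi>[OF \<open>b \<in> X\<close> that]])
  qed
  have \<kappa>_nonneg: "0 \<le> \<kappa> a b" if "a \<in> X" "b \<in> X" for a b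
    unfolding \<kappa>_def N.ip_def using \<xi>[OF that(1)] \<xi>[OF that(2)]
    by (intro N.nonneg bounded_funs_mult \<xi>B that) simp
  have \<kappa>B: "(\<lambda>a. \<kappa> a b) \<in> bounded_funs X" if "b \<in> X" for b
    using \<kappa>_abs that by (intro bounded_funsI[where C = 1])
  have mean_sq: "(\<nu> u)\<^sup>2 \<le> N.ip u u" if "u \<in> bounded_funs Y" for u
    using N.cauchy_schwarz[OF that bounded_funs_const[of 1]] by (simp add: N.ip_def N.one)
  define sep where "sep S \<longleftrightarrow> finite S \<and> S \<subseteq> A \<and> (\<forall>s\<in>S. \<forall>t\<in>S. s \<noteq> t \<longrightarrow> \<kappa> s t < \<epsilon>)" for S
  have sep_card: "card S \<le> nat \<lceil>2 / \<beta>\<^sup>2\<rceil>" if S: "sep S" for S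
  proof (cases "S = {}")
    case False
    have fin: "finite S" and SX: "\<And>s. s \<in> S \<Longrightarrow> s \<in> X" using S A(1) by (auto simp: sep_def)
    define n where "n = real (card S)"
    have n: "n > 0" using False fin by (simp add: n_def card_gt_0_iff)
    let ?u = "\<lambda>y. \<Sum>s\<in>S. \<xi> s y"
    have uB: "?u \<in> bounded_funs Y" using \<xi>B SX by (intro bounded_funs_sum) blast
    have "n * \<beta> = (\<Sum>s\<in>S. \<beta>)" by (simp add: n_def)
    also have "\<dots> \<le> (\<Sum>s\<in>S. \<nu> (\<xi> s))" using \<beta>(2) SX by (intro sum_mono) blast
    also have "\<dots> = \<nu> ?u" using \<xi>B SX by (intro N.sum[symmetric] fin) blast
    finally have "(n * \<beta>)\<^sup>2 \<le> (\<nu> ?u)\<^sup>2" using n \<beta>(1) by (intro power_mono) auto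
    also have "\<dots> \<le> N.ip ?u ?u" by (rule mean_sq[OF uB])
    also have "\<dots> = (\<Sum>s\<in>S. N.ip (\<xi> s) ?u)"
      using \<xi>B SX by (intro N.ip_sum fin uB) blast
    also have "\<dots> = (\<Sum>s\<in>S. \<Sum>t\<in>S. \<kappa> s t)"
    proof (rule sum.cong[OF refl])
      fix s assume s: "s \<in> S"
      have "N.ip (\<xi> s) ?u = N.ip ?u (\<xi> s)" by (rule N.ip_commute)
      also have "\<dots> = (\<Sum>t\<in>S. N.ip (\<xi> t) (\<xi> s))" using \<xi>B SX s by (intro N.ip_sum fin) blast+
      also have "\<dots> = (\<Sum>t\<in>S. \<kappa> s t)" unfolding \<kappa>_def by (intro sum.cong refl N.ip_commute)
      finally show "N.ip (\<xi> s) ?u = (\<Sum>t\<in>S. \<kappa> s t)" .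
    qed
    also have "\<dots> \<le> (\<Sum>s\<in>S. \<Sum>t\<in>S. (if s = t then 1 else 0) + \<epsilon>)"
    proof (intro sum_mono)
      fix s t assume st: "s \<in> S" "t \<in> S"
      show "\<kappa> s t \<le> (if s = t then 1 else 0) + \<epsilon>"
      proof (cases "s = t")
        case True
        then show ?thesis using \<kappa>_abs[OF SX[OF st(1)] SX[OF st(1)]] \<epsilon> by simp
      next
        case False
        then have "\<kappa> s t < \<epsilon>" using S st by (simp add: sep_def)
        then show ?thesis using False by simp
      qed
    qed
    also have "\<dots> = n + n * (n * \<epsilon>)"
      using fin by (simp add: sum.distrib n_def distrib_left)
    finally have "n * (n * \<beta>\<^sup>2) \<le> n * (1 + n * \<epsilon>)"
      by (simp add: power2_eq_square distrib_left mult.assoc mult.left_commute)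
    then have "n * \<beta>\<^sup>2 \<le> 1 + n * \<epsilon>" using n by simp
    then have "n * \<beta>\<^sup>2 \<le> 2" by (simp add: \<epsilon>_def)
    then have "n \<le> 2 / \<beta>\<^sup>2" using \<beta>(1) by (simp add: pos_le_divide_eq)
    then show ?thesis unfolding n_def by linarith
  qed simp
  have "sep {}" by (simp add: sep_def)
  then obtain S where S: "sep S" and max: "\<And>S'. sep S' \<Longrightarrow> card S' \<le> card S"
    using ex_has_greatest_nat[of sep "{}" card "Suc (nat \<lceil>2 / \<beta>\<^sup>2\<rceil>)"] sep_card
    by (metis le_imp_less_Suc)
  have fin: "finite S" and SA: "S \<subseteq> A" and SX: "\<And>s. s \<in> S \<Longrightarrow> s \<in> X"
    using S A(1) by (auto simp: sep_def)
  have cover: "\<exists>s\<in>S. \<epsilon> \<le> \<kappa> a s" if a: "a \<in> A" for a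
  proof (cases "a \<in> S")
    case True
    have aX: "a \<in> X" using a A(1) by blast
    have "\<beta>\<^sup>2 \<le> (\<nu> (\<xi> a))\<^sup>2" using \<beta>(1) \<beta>(2)[OF aX] by (intro power_mono) auto
    also have "\<dots> \<le> \<kappa> a a" unfolding \<kappa>_def by (rule mean_sq[OF \<xi>B[OF aX]])
    finally have "\<epsilon> \<le> \<kappa> a a" using zero_le_power2[of \<beta>] unfolding \<epsilon>_def by linarith
    then show ?thesis using True by blast
  next
    case False
    then have "\<not> sep (insert a S)" using max[of "insert a S"] fin by auto
    then obtain s t where st: "s \<in> insert a S" "t \<in> insert a S" "s \<noteq> t" "\<epsilon> \<le> \<kappa> s t"
      using fin SA a unfolding sep_def by (auto simp: not_less)
    have "\<not> (s \<in> S \<and> t \<in> S)" using S st(3,4) unfolding sep_def by (meson not_less)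
    then have "(s = a \<and> t \<in> S) \<or> (t = a \<and> s \<in> S)" using st(1-3) by blast
    then show ?thesis using st(4) N.ip_commute unfolding \<kappa>_def by metis
  qed
  have term_B: "(\<lambda>a. indicat_real A a * \<kappa> a s) \<in> bounded_funs X" if "s \<in> S" for s
    by (intro bounded_funs_mult bounded_funs_indicator \<kappa>B SX that)
  have "\<epsilon> * \<mu> (indicat_real A) = \<mu> (\<lambda>a. \<epsilon> * indicat_real A a)"
    by (rule M.scale[symmetric, OF bounded_funs_indicator])
  also have "\<dots> \<le> \<mu> (\<lambda>a. \<Sum>s\<in>S. indicat_real A a * \<kappa> a s)"
  proof (rule M.mono)
    show "(\<lambda>a. \<epsilon> * indicat_real A a) \<in> bounded_funs X" by (intro bounded_funs_scale bounded_funs_indicator)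
    show "(\<lambda>a. \<Sum>s\<in>S. indicat_real A a * \<kappa> a s) \<in> bounded_funs X" by (intro bounded_funs_sum term_B)
    fix a assume a: "a \<in> X"
    show "\<epsilon> * indicat_real A a \<le> (\<Sum>s\<in>S. indicat_real A a * \<kappa> a s)"
    proof (cases "a \<in> A")
      case True
      then obtain s where s: "s \<in> S" "\<epsilon> \<le> \<kappa> a s" using cover by blast
      have "\<kappa> a s \<le> (\<Sum>s\<in>S. \<kappa> a s)" using s(1) fin \<kappa>_nonneg[OF a] SX by (intro member_le_sum) auto
      then show ?thesis using s(2) True by simp
    qed simp
  qed
  also have "\<dots> = (\<Sum>s\<in>S. \<mu> (\<lambda>a. indicat_real A a * \<kappa> a s))"
    by (intro M.sum fin term_B)
  finally have "0 < (\<Sum>s\<in>S. \<mu> (\<lambda>a. indicat_real A a * \<kappa> a s))"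
    using mult_pos_pos[OF \<epsilon> A(2)] by linarith
  then obtain s where "s \<in> S" "0 < \<mu> (\<lambda>a. indicat_real A a * \<kappa> a s)"
    using sum_nonpos[of S "\<lambda>s. \<mu> (\<lambda>a. indicat_real A a * \<kappa> a s)"] by (meson not_less)
  then show ?thesis using SA by (intro bexI[of _ s]) (auto simp: \<kappa>_def N.ip_def)
qed

text \<open>
  In terms of the sets, \<open>\<xi> a\<close> is the indicator function of \<open>a B\<close>, \<open>correlation a b\<close> is
  \<open>\<nu> (a B \<inter> b B)\<close>, and \<open>smoothed b\<close> averages the correlation with \<open>b\<close> over the translates of \<open>A\<close>.
\<close>
locale two_invariant_means = M: invariant_mean G \<mu> + N: invariant_mean G \<nu>
  for G :: "('a, 'm) monoid_scheme" (structure) and \<mu> \<nu> +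
  fixes A B :: "'a set"
begin

definition \<xi> :: "'a \<Rightarrow> 'a \<Rightarrow> real" where
  "\<xi> a x = indicat_real B (inv a \<otimes> x)"

definition correlation :: "'a \<Rightarrow> 'a \<Rightarrow> real" where
  "correlation a b = \<nu> (\<lambda>x. \<xi> a x * \<xi> b x)"

definition smoothed :: "'a \<Rightarrow> 'a \<Rightarrow> real" where
  "smoothed b g = \<mu> (\<lambda>a. indicat_real A (inv g \<otimes> a) * correlation a b)"

lemma \<xi>_bounds: "0 \<le> \<xi> a x" "\<xi> a x \<le> 1" "\<bar>\<xi> a x\<bar> \<le> 1"
  by (simp_all add: \<xi>_def indicator_def)

lemma \<xi>_bounded: "\<xi> a \<in> bounded_funs (carrier G)"
  by (rule bounded_funsI[where C = 1]) (rule \<xi>_bounds)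

lemma correlation_abs: "\<bar>correlation a b\<bar> \<le> 1"
  unfolding correlation_def
proof (rule N.abs_le)
  show "\<bar>\<xi> a x * \<xi> b x\<bar> \<le> 1" for x
    unfolding abs_mult by (rule mult_le_one[OF \<xi>_bounds(3) abs_ge_zero \<xi>_bounds(3)])
qed

lemma shifted_abs: "\<bar>indicat_real A (inv g \<otimes> a)\<bar> \<le> 1"
  by (simp add: indicator_def)

lemma kernel_bounded: "(\<lambda>a. indicat_real A (inv g \<otimes> a) * correlation a b) \<in> bounded_funs (carrier G)"
  by (intro bounded_funs_mult bounded_funsI[where C = 1] shifted_abs correlation_abs)

lemma correlation_translate:
  assumes k: "k \<in> carrier G" and a: "a \<in> carrier G" and b: "b \<in> carrier G"
  shows "correlation (k \<otimes> a) b = correlation a (inv k \<otimes> b)"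
proof -
  have "correlation (k \<otimes> a) b = \<nu> (\<lambda>x. \<xi> (k \<otimes> a) (k \<otimes> x) * \<xi> b (k \<otimes> x))"
    unfolding correlation_def
    by (rule N.invariant[symmetric, OF k]) (intro bounded_funs_mult \<xi>_bounded)
  also have "\<dots> = \<nu> (\<lambda>x. \<xi> a x * \<xi> (inv k \<otimes> b) x)"
  proof (rule N.cong[symmetric])
    show "(\<lambda>x. \<xi> a x * \<xi> (inv k \<otimes> b) x) \<in> bounded_funs (carrier G)"
      by (intro bounded_funs_mult \<xi>_bounded)
    fix x assume x: "x \<in> carrier G"
    have "inv (k \<otimes> a) \<otimes> (k \<otimes> x) = inv a \<otimes> (inv k \<otimes> k \<otimes> x)"
      using k a x by (simp only: M.inv_mult_group M.m_assoc M.inv_closed M.m_closed)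
    then have 1: "inv (k \<otimes> a) \<otimes> (k \<otimes> x) = inv a \<otimes> x" using k x by simp
    have 2: "inv (inv k \<otimes> b) \<otimes> x = inv b \<otimes> (k \<otimes> x)" using k b x by (simp add: M.inv_mult_group M.m_assoc)
    show "\<xi> a x * \<xi> (inv k \<otimes> b) x = \<xi> (k \<otimes> a) (k \<otimes> x) * \<xi> b (k \<otimes> x)"
      unfolding \<xi>_def 1 2 ..
  qed
  finally show ?thesis unfolding correlation_def .
qed

text \<open>
  Both means are invariant, so a left translation of the argument becomes a translation of the base
  point.
\<close>
lemma smoothed_translate:
  assumes k: "k \<in> carrier G" and g: "g \<in> carrier G" and b: "b \<in> carrier G"
  shows "smoothed b (k \<otimes> g) = smoothed (inv k \<otimes> b) g"
proof -
  have "smoothed b (k \<otimes> g) = \<mu> (\<lambda>a. indicat_real A (inv (k \<otimes> g) \<otimes> (k \<otimes> a)) * correlation (k \<otimes> a) b)"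
    unfolding smoothed_def by (rule M.invariant[symmetric, OF k kernel_bounded])
  also have "\<dots> = \<mu> (\<lambda>a. indicat_real A (inv g \<otimes> a) * correlation a (inv k \<otimes> b))"
  proof (rule M.cong[symmetric, OF kernel_bounded])
    fix a assume a: "a \<in> carrier G"
    have "inv (k \<otimes> g) \<otimes> (k \<otimes> a) = inv g \<otimes> (inv k \<otimes> k \<otimes> a)"
      using k a g by (simp only: M.inv_mult_group M.m_assoc M.inv_closed M.m_closed)
    then have "inv (k \<otimes> g) \<otimes> (k \<otimes> a) = inv g \<otimes> a" using k a by simp
    then show "indicat_real A (inv g \<otimes> a) * correlation a (inv k \<otimes> b) =
        indicat_real A (inv (k \<otimes> g) \<otimes> (k \<otimes> a)) * correlation (k \<otimes> a) b"
      by (simp add: correlation_translate[OF k a b])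
  qed
  finally show ?thesis unfolding smoothed_def .
qed

text \<open>
  By \<open>smoothed_translate\<close>, the values at \<open>k g\<close> are the values at \<open>g\<close> for the base point \<open>k\<^sup>-\<^sup>1 b\<close>. The
  finite rank approximation holds for all base points at once, so \<open>g\<close> enters, up to a small error,
  only through finitely many coefficients \<open>c g e\<close> in \<open>[-1, 1]\<close>. Rounding these to multiples of a
  small \<open>s\<close> leaves finitely many classes of elements \<open>g\<close>.
\<close>
lemma smoothed_almost_periodic:
  assumes b: "b \<in> carrier G"
  shows "M.almost_periodic (smoothed b)"
  unfolding M.almost_periodic_def
proof (intro conjI allI impI)
  show "smoothed b \<in> bounded_funs (carrier G)"
  proof (rule bounded_funsI[where C = 1])
    show "\<bar>smoothed b g\<bar> \<le> 1" for g
      unfolding smoothed_def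
    proof (rule M.abs_le)
      show "\<bar>indicat_real A (inv g \<otimes> a) * correlation a b\<bar> \<le> 1" for a
        unfolding abs_mult by (rule mult_le_one[OF shifted_abs abs_ge_zero correlation_abs])
    qed
  qed
  fix \<epsilon> :: real assume "\<epsilon> > 0"
  then have e4: "\<epsilon> / 4 > 0" by simp
  from mean_kernel_finite_rank[where \<xi> = \<xi>, OF M.mean_functional_axioms N.mean_functional_axioms \<xi>_bounds(3) e4]
  obtain E :: "('a \<Rightarrow> real) set" and u where E: "finite E"
    and u': "\<forall>e\<in>E. \<forall>a\<in>carrier G. \<bar>u e a\<bar> \<le> 1"
    and approx: "\<forall>f. (\<forall>a\<in>carrier G. \<bar>f a\<bar> \<le> 1) \<longrightarrow> (\<forall>b\<in>carrier G.
      \<bar>\<mu> (\<lambda>a. f a * \<nu> (\<lambda>y. \<xi> a y * \<xi> b y)) - (\<Sum>e\<in>E. u e b * \<mu> (\<lambda>a. f a * u e a))\<bar> \<le> \<epsilon> / 4)"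
    by (elim exE conjE) (rule that)
  have u: "\<bar>u e a\<bar> \<le> 1" if "e \<in> E" "a \<in> carrier G" for e a using u' that by blast
  define c where "c g e = \<mu> (\<lambda>a. indicat_real A (inv g \<otimes> a) * u e a)" for g e
  have c1: "\<bar>c g e\<bar> \<le> 1" if "e \<in> E" for g e
    unfolding c_def
  proof (rule M.abs_le)
    show "\<bar>indicat_real A (inv g \<otimes> a) * u e a\<bar> \<le> 1" if "a \<in> carrier G" for a
      unfolding abs_mult by (rule mult_le_one[OF shifted_abs abs_ge_zero u[OF \<open>e \<in> E\<close> that]])
  qed
  have near: "\<bar>smoothed b' g - (\<Sum>e\<in>E. u e b' * c g e)\<bar> \<le> \<epsilon> / 4" if "b' \<in> carrier G" for b' g
    unfolding smoothed_def correlation_def c_def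
    by (rule bspec[OF mp[OF spec[OF approx]] that]) (simp add: shifted_abs)
  \<comment> \<open>An error of \<open>s\<close> in each coefficient adds up to at most \<open>\<epsilon> / 2\<close>; adding 1 covers \<open>E = {}\<close>.\<close>
  define s where "s = \<epsilon> / (2 * (real (card E) + 1))"
  have s: "s > 0" "real (card E) * s \<le> \<epsilon> / 2"
    using \<open>\<epsilon> > 0\<close> by (simp_all add: s_def field_simps)
  define p where "p g = (\<lambda>e\<in>E. \<lfloor>c g e / s\<rfloor>)" for g
  have "p ` carrier G \<subseteq> E \<rightarrow>\<^sub>E {\<lfloor>- 1 / s\<rfloor>..\<lfloor>1 / s\<rfloor>}"
  proof -
    have "\<lfloor>c g e / s\<rfloor> \<in> {\<lfloor>- 1 / s\<rfloor>..\<lfloor>1 / s\<rfloor>}" if "e \<in> E" for g e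
    proof -
      have "- 1 / s \<le> c g e / s" by (rule divide_right_mono) (use c1[OF that, of g] s(1) in auto)
      moreover have "c g e / s \<le> 1 / s" by (rule divide_right_mono) (use c1[OF that, of g] s(1) in auto)
      ultimately show ?thesis by (simp only: atLeastAtMost_iff floor_mono)
    qed
    then show ?thesis by (auto simp: p_def)
  qed
  moreover have "finite (E \<rightarrow>\<^sub>E {\<lfloor>- 1 / s\<rfloor>..\<lfloor>1 / s\<rfloor>})" using E by (intro finite_PiE) auto
  ultimately have "finite (p ` carrier G)" by (rule finite_subset)
  from finite_image_representatives[OF this]
  obtain R where R: "finite R" "R \<subseteq> carrier G" "\<And>g. g \<in> carrier G \<Longrightarrow> \<exists>h\<in>R. p g = p h" by blast
  have close: "\<bar>smoothed b (k \<otimes> g) - smoothed b (k \<otimes> h)\<bar> \<le> \<epsilon>"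
    if k: "k \<in> carrier G" and g: "g \<in> carrier G" and h: "h \<in> carrier G" and gh: "p g = p h" for k g h
  proof -
    define b' where "b' = inv k \<otimes> b"
    have b': "b' \<in> carrier G" using k b by (simp add: b'_def)
    have cs: "\<bar>c g e - c h e\<bar> \<le> s" if "e \<in> E" for e
    proof -
      have "\<lfloor>c g e / s\<rfloor> = \<lfloor>c h e / s\<rfloor>" using fun_cong[OF gh, of e] that by (simp add: p_def)
      then have "\<bar>c g e / s - c h e / s\<bar> \<le> 1" by linarith
      then have "\<bar>(c g e - c h e) / s\<bar> \<le> 1" by (simp add: diff_divide_distrib)
      then show ?thesis using s(1) by (simp add: abs_divide divide_le_eq)
    qed
    have "\<bar>(\<Sum>e\<in>E. u e b' * c g e) - (\<Sum>e\<in>E. u e b' * c h e)\<bar> = \<bar>\<Sum>e\<in>E. u e b' * (c g e - c h e)\<bar>"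
      by (simp add: right_diff_distrib sum_subtractf)
    also have "\<dots> \<le> (\<Sum>e\<in>E. \<bar>u e b' * (c g e - c h e)\<bar>)" by (rule sum_abs)
    also have "\<dots> \<le> (\<Sum>e\<in>E. 1 * s)"
      unfolding abs_mult using u b' cs by (intro sum_mono mult_mono') auto
    also have "\<dots> \<le> \<epsilon> / 2" using s(2) by simp
    finally have "\<bar>(\<Sum>e\<in>E. u e b' * c g e) - (\<Sum>e\<in>E. u e b' * c h e)\<bar> \<le> \<epsilon> / 2" .
    moreover have "smoothed b (k \<otimes> g) = smoothed b' g" "smoothed b (k \<otimes> h) = smoothed b' h"
      unfolding b'_def using smoothed_translate[OF k g b] smoothed_translate[OF k h b] by auto
    ultimately show ?thesis using near[OF b', of g] near[OF b', of h] by linarith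
  qed
  show "\<exists>N. finite N \<and> N \<subseteq> carrier G \<and> (\<forall>g\<in>carrier G. \<exists>h\<in>N. \<forall>k\<in>carrier G.
      \<bar>smoothed b (k \<otimes> g) - smoothed b (k \<otimes> h)\<bar> \<le> \<epsilon>)"
  proof (intro exI[of _ R] conjI ballI)
    fix g assume g: "g \<in> carrier G"
    then obtain h where h: "h \<in> R" "p g = p h" using R(3) by blast
    have "\<forall>k\<in>carrier G. \<bar>smoothed b (k \<otimes> g) - smoothed b (k \<otimes> h)\<bar> \<le> \<epsilon>"
      using close[OF _ g subsetD[OF R(2) h(1)] h(2)] by blast
    with h(1) show "\<exists>h\<in>R. \<forall>k\<in>carrier G. \<bar>smoothed b (k \<otimes> g) - smoothed b (k \<otimes> h)\<bar> \<le> \<epsilon>"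
      by (rule rev_bexI)
  qed (rule R)+
qed

lemma smoothed_positive_at_unit:
  assumes A: "A \<subseteq> carrier G" "0 < \<mu> (indicat_real A)" and B: "0 < \<nu> (indicat_real B)"
  obtains b where "b \<in> A" "0 < smoothed b \<one>"
proof -
  have \<xi>_mean: "\<nu> (\<xi> a) = \<nu> (indicat_real B)" if a: "a \<in> carrier G" for a
    unfolding \<xi>_def
    by (rule N.invariant[OF M.inv_closed[OF a] bounded_funs_indicator])
  have "\<exists>b\<in>A. 0 < \<mu> (\<lambda>a. indicat_real A a * \<nu> (\<lambda>x. \<xi> a x * \<xi> b x))"
    by (rule positive_correlation[where \<xi> = \<xi>, OF M.mean_functional_axioms N.mean_functional_axioms _ B _ A])
      (simp_all add: \<xi>_bounds \<xi>_mean)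
  then obtain b where b: "b \<in> A" "0 < \<mu> (\<lambda>a. indicat_real A a * correlation a b)"
    unfolding correlation_def by blast
  have "smoothed b \<one> = \<mu> (\<lambda>a. indicat_real A a * correlation a b)"
    unfolding smoothed_def by (rule M.cong[OF kernel_bounded]) simp
  with b show thesis by (intro that) auto
qed

text \<open>
  A positive mean has a nonzero value: there are \<open>a\<close> with \<open>g\<^sup>-\<^sup>1 a \<in> A\<close> and \<open>x \<in> a B \<inter> b B\<close>. Then
  \<open>g = b (b\<^sup>-\<^sup>1 x) (a\<^sup>-\<^sup>1 x)\<^sup>-\<^sup>1 (g\<^sup>-\<^sup>1 a)\<^sup>-\<^sup>1\<close> is of the required form.
\<close>
lemma smoothed_positive_imp_product:
  assumes B: "B \<subseteq> carrier G" and A: "A \<subseteq> carrier G"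
    and b: "b \<in> A" and g: "g \<in> carrier G" and pos: "0 < smoothed b g"
  obtains a1 a2 b1 b2 where "a1 \<in> A" "a2 \<in> A" "b1 \<in> B" "b2 \<in> B"
    "g = a1 \<otimes> b1 \<otimes> inv b2 \<otimes> inv a2"
proof -
  have "\<exists>a\<in>carrier G. indicat_real A (inv g \<otimes> a) * correlation a b \<noteq> 0"
  proof (rule ccontr)
    assume "\<not> ?thesis"
    then have "smoothed b g = \<mu> (\<lambda>a. 0)"
      unfolding smoothed_def by (intro M.cong kernel_bounded) blast
    with pos M.const[of 0] show False by simp
  qed
  then obtain a where a: "a \<in> carrier G" "inv g \<otimes> a \<in> A" "correlation a b \<noteq> 0"
    by (auto simp: indicator_def split: if_splits)
  have "\<exists>x\<in>carrier G. \<xi> a x * \<xi> b x \<noteq> 0"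
  proof (rule ccontr)
    assume "\<not> ?thesis"
    then have "correlation a b = \<nu> (\<lambda>x. 0)"
      unfolding correlation_def by (intro N.cong bounded_funs_mult \<xi>_bounded) blast
    with a(3) N.const[of 0] show False by simp
  qed
  then obtain x where x: "x \<in> carrier G" "inv a \<otimes> x \<in> B" "inv b \<otimes> x \<in> B"
    by (auto simp: \<xi>_def indicator_def split: if_splits)
  have bG: "b \<in> carrier G" using b A by blast
  have "b \<otimes> (inv b \<otimes> x) = x" using bG x(1) by (simp add: M.m_assoc[symmetric])
  moreover have "x \<otimes> inv (inv a \<otimes> x) = a"
    using a(1) x(1) by (simp add: M.inv_mult_group M.m_assoc[symmetric])
  moreover have "a \<otimes> inv (inv g \<otimes> a) = g"
    using a(1) g by (simp add: M.inv_mult_group M.m_assoc[symmetric])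
  ultimately have "g = b \<otimes> (inv b \<otimes> x) \<otimes> inv (inv a \<otimes> x) \<otimes> inv (inv g \<otimes> a)" by simp
  then show thesis by (rule that[OF b a(2) x(3,2)])
qed

end

theorem corollary16p9:
  fixes G :: "('a, 'm) monoid_scheme" (structure)
    and bG :: "'b monoid" and T :: "'b topology" and \<eta> :: "'a \<Rightarrow> 'b"
    and A B :: "'a set"
  assumes "amenable_group G"
    and "bohr_compactification G bG T \<eta>"
    and "A \<subseteq> carrier G" and "B \<subseteq> carrier G"
    and "sigma_R G A > 0" and "sigma_R G B > 0"
  shows "\<exists>U. openin (bohr_topology G T \<eta>) U \<and> \<one> \<in> U \<and>
    U \<subseteq> {a1 \<otimes> b1 \<otimes> inv b2 \<otimes> inv a2 | a1 a2 b1 b2. a1 \<in> A \<and> a2 \<in> A \<and> b1 \<in> B \<and> b2 \<in> B}"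
proof -
  obtain \<mu> where \<mu>: "invariant_mean G \<mu>" "0 < \<mu> (indicat_real A)"
    using invariant_mean_positive[OF assms(1,3,5)] .
  obtain \<nu> where \<nu>: "invariant_mean G \<nu>" "0 < \<nu> (indicat_real B)"
    using invariant_mean_positive[OF assms(1,4,6)] .
  interpret two_invariant_means G \<mu> \<nu> A B
    using \<mu>(1) \<nu>(1) by (rule two_invariant_means.intro)
  obtain b where b: "b \<in> A" "0 < smoothed b \<one>"
    using smoothed_positive_at_unit[OF assms(3) \<mu>(2) \<nu>(2)] .
  have "b \<in> carrier G" using b(1) assms(3) by blast
  from M.almost_periodic_bohr_continuous[OF assms(2) smoothed_almost_periodic[OF this] b(2)]
  obtain U where U: "openin (bohr_topology G T \<eta>) U" "\<one> \<in> U" "U \<subseteq> carrier G"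
    and near: "\<forall>g\<in>U. \<bar>smoothed b g - smoothed b \<one>\<bar> < smoothed b \<one>"
    by (elim exE conjE) (rule that)
  have prod: "\<exists>a1 a2 b1 b2. g = a1 \<otimes> b1 \<otimes> inv b2 \<otimes> inv a2 \<and> a1 \<in> A \<and> a2 \<in> A \<and> b1 \<in> B \<and> b2 \<in> B"
    if g: "g \<in> U" for g
  proof -
    have "0 < smoothed b g" using bspec[OF near g] by linarith
    from smoothed_positive_imp_product[OF assms(4,3) b(1) subsetD[OF U(3) g] this]
    obtain a1 a2 b1 b2 where "a1 \<in> A" "a2 \<in> A" "b1 \<in> B" "b2 \<in> B"
      "g = a1 \<otimes> b1 \<otimes> inv b2 \<otimes> inv a2" .
    then show ?thesis by (intro exI conjI)
  qed
  show ?thesis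
    by (intro exI[of _ U] conjI U(1,2) subsetI CollectI prod)
qed

end
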